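(* Let $X=(X_n)_{n\ge 0}$ be the random walk in the sparse random environment $\omega$ built from a sequence of pairs $(\lambda_n,d_n)_{n\in\mathbb{Z}}$, $\lambda_n\in(0,1)$, $d_n\in\mathbb{N}$, started at $X_0=0$, with annealed law $\mathbb{P}$, and let $\xi_n=(1-\lambda_n)/\lambda_n$. Suppose that: (1) the sequence of pairs $(d_n,\lambda_n)_{n\in\mathbb{Z}}$ is stationary and ergodic under $P$; (2) $E_P(\log \xi_0)$ exists (possibly infinite); (3) $E_P(\log d_0)<\infty$. Then: (a) $E_P(\log\xi_0)<0$ implies $\lim_{n\to\infty} X_n=+\infty$, $\mathbb{P}$-a.s.; (b) $E_P(\log\xi_0)>0$ implies $\lim_{n\to\infty} X_n=-\infty$, $\mathbb{P}$-a.s.; (c) $E_P(\log\xi_0)=0$ implies $\liminf_{n\to\infty} X_n=-\infty$ and $\limsup_{n\to\infty} X_n=+\infty$, $\mathbb{P}$-a.s.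
   Context: Sparse environment: $(\lambda_k,d_k)_{k\in\mathbb{Z}}$ is a sequence of random pairs with joint law $P$ (expectation $E_P$), $\lambda_k\in(0,1)$, $d_k\in\mathbb{N}=\{1,2,\dots\}$. Set $a_0=0$, $a_n=\sum_{k=1}^n d_k$ for $n>0$, and $a_n=-\sum_{k=n+1}^{0}d_k$ for $n<0$ (so $a_n-a_{n-1}=d_n$ for all $n$). The sparse random environment $\omega=(\omega_n)_{n\in\mathbb{Z}}$ is $\omega_n=\lambda_k$ if $n=a_k$ for some $k\in\mathbb{Z}$, and $\omega_n=1/2$ otherwise. Random walk: given $\omega$, $(X_n)_{n\ge0}$ is the Markov chain on $\mathbb{Z}$ with $X_0=0$ that jumps from $i$ to $i+1$ with probability $\omega_i$ and from $i$ to $i-1$ with probability $1-\omega_i$; its law is the quenched law $P_\omega$. The annealed law is $\mathbb{P}=P\otimes P_\omega$, i.e. $\mathbb{P}(F\times G)=\int_F P_\omega(G)\,dP$. *)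

theory Defs
  imports "HOL-Probability.Probability"
begin

section \<open>Sparse random environments\<close>

text \<open>
  The law of the sequence of pairs \<open>(\<lambda>\<^sub>k, d\<^sub>k)\<close>, \<open>k\<close> an integer, is a probability measure on
  the following product space, in which \<open>\<lambda>\<^sub>k\<close> lies in the open unit interval and \<open>d\<^sub>k \<ge> 1\<close>.
\<close>

definition mark_space :: "(real \<times> nat) measure" where
  "mark_space = restrict_space borel {0<..<1} \<Otimes>\<^sub>M count_space {1..}"

definition seq_space :: "(int \<Rightarrow> real \<times> nat) measure" where
  "seq_space = Pi\<^sub>M UNIV (\<lambda>_. mark_space)"

definition lam :: "(int \<Rightarrow> real \<times> nat) \<Rightarrow> int \<Rightarrow> real" where
  "lam e k = fst (e k)"

definition gap :: "(int \<Rightarrow> real \<times> nat) \<Rightarrow> int \<Rightarrow> nat" where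
  "gap e k = snd (e k)"

definition xi :: "(int \<Rightarrow> real \<times> nat) \<Rightarrow> int \<Rightarrow> real" where
  "xi e k = (1 - lam e k) / lam e k"

definition site :: "(int \<Rightarrow> real \<times> nat) \<Rightarrow> int \<Rightarrow> int" where
  "site e n = (if 0 \<le> n then (\<Sum>k\<in>{1..n}. int (gap e k)) else - (\<Sum>k\<in>{n+1..0}. int (gap e k)))"

text \<open>On \<open>seq_space\<close> the map \<open>site e\<close> is strictly increasing, so the index below is unique.\<close>

definition sparse_env :: "(int \<Rightarrow> real \<times> nat) \<Rightarrow> int \<Rightarrow> real" where
  "sparse_env e n = (if \<exists>k. site e k = n then lam e (THE k. site e k = n) else 1 / 2)"


section \<open>Stationarity, ergodicity and extended expectations\<close>

definition shift :: "(int \<Rightarrow> 'a) \<Rightarrow> int \<Rightarrow> 'a" where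
  "shift e k = e (k + 1)"

definition stationary_law :: "(int \<Rightarrow> 'a) measure \<Rightarrow> bool" where
  "stationary_law P \<longleftrightarrow> distr P P shift = P"

definition ergodic_law :: "(int \<Rightarrow> 'a) measure \<Rightarrow> bool" where
  "ergodic_law P \<longleftrightarrow>
     (\<forall>A\<in>sets P. shift -` A \<inter> space P = A \<longrightarrow> measure P A = 0 \<or> measure P A = 1)"

text \<open>
  Since \<open>ennreal\<close> truncates negative reals to zero, the two integrals below are those of the
  positive and of the negative part of \<open>f\<close>.
\<close>

definition expectation_exists :: "'a measure \<Rightarrow> ('a \<Rightarrow> real) \<Rightarrow> bool" where
  "expectation_exists M f \<longleftrightarrow> f \<in> borel_measurable M \<and>
     ((\<integral>\<^sup>+ x. ennreal (f x) \<partial>M) < \<infinity> \<or> (\<integral>\<^sup>+ x. ennreal (- f x) \<partial>M) < \<infinity>)"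

definition ext_expectation :: "'a measure \<Rightarrow> ('a \<Rightarrow> real) \<Rightarrow> ereal" where
  "ext_expectation M f =
     enn2ereal (\<integral>\<^sup>+ x. ennreal (f x) \<partial>M) - enn2ereal (\<integral>\<^sup>+ x. ennreal (- f x) \<partial>M)"


section \<open>Quenched and annealed laws of the walk\<close>

definition step_pmf :: "(int \<Rightarrow> real) \<Rightarrow> int \<Rightarrow> int pmf" where
  "step_pmf \<omega> i = map_pmf (\<lambda>b. if b then i + 1 else i - 1) (bernoulli_pmf (\<omega> i))"

definition path_space :: "(nat \<Rightarrow> int) measure" where
  "path_space = Pi\<^sub>M UNIV (\<lambda>_. count_space UNIV)"

text \<open>The conditional law of the position at time \<open>n\<close> given the path \<open>x\<close> before time \<open>n\<close>.\<close>

definition walk_kernel :: "(int \<Rightarrow> real) \<Rightarrow> nat \<Rightarrow> (nat \<Rightarrow> int) \<Rightarrow> int measure" where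
  "walk_kernel \<omega> n x =
     measure_pmf (case n of 0 \<Rightarrow> return_pmf 0 | Suc m \<Rightarrow> step_pmf \<omega> (x m))"

definition quenched :: "(int \<Rightarrow> real) \<Rightarrow> (nat \<Rightarrow> int) measure" where
  "quenched \<omega> =
     projective_family.lim UNIV (Ionescu_Tulcea.CI (walk_kernel \<omega>) (\<lambda>_. count_space UNIV))
       (\<lambda>_. count_space UNIV)"

definition annealed ::
  "(int \<Rightarrow> real \<times> nat) measure \<Rightarrow> ((int \<Rightarrow> real \<times> nat) \<times> (nat \<Rightarrow> int)) measure" where
  "annealed P = P \<bind> (\<lambda>e. distr (quenched (sparse_env e)) (P \<Otimes>\<^sub>M path_space) (Pair e))"

lemma Ionescu_Tulcea_walk: "Ionescu_Tulcea (walk_kernel \<omega>) (\<lambda>_. count_space UNIV)"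
proof (rule Ionescu_Tulcea.intro)
  fix i :: nat
  show "walk_kernel \<omega> i \<in> measurable (Pi\<^sub>M {0..<i} (\<lambda>_. count_space UNIV))
      (subprob_algebra (count_space UNIV))"
  proof (cases i)
    case 0
    show ?thesis unfolding walk_kernel_def[abs_def] 0
      by (auto simp: space_subprob_algebra intro!: measurable_const prob_space_imp_subprob_space
            measure_pmf.prob_space_axioms)
  next
    case (Suc m)
    have "(\<lambda>x. x m) \<in> measurable (Pi\<^sub>M {0..<i} (\<lambda>_. count_space UNIV)) (count_space (UNIV::int set))"
      using Suc by (intro measurable_component_singleton) auto
    moreover have "(\<lambda>y. measure_pmf (step_pmf \<omega> y)) \<in>
        measurable (count_space UNIV) (subprob_algebra (count_space UNIV))"
      by (auto simp: space_subprob_algebra intro!: prob_space_imp_subprob_space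
            measure_pmf.prob_space_axioms)
    ultimately have "(\<lambda>x. measure_pmf (step_pmf \<omega> (x m))) \<in> measurable
        (Pi\<^sub>M {0..<i} (\<lambda>_. count_space UNIV)) (subprob_algebra (count_space UNIV))"
      by (rule measurable_compose)
    then show ?thesis by (simp add: walk_kernel_def[abs_def] Suc)
  qed
next
  show "prob_space (walk_kernel \<omega> i x)" for i x
    unfolding walk_kernel_def by (rule measure_pmf.prob_space_axioms)
qed


interpretation walk: Ionescu_Tulcea "walk_kernel \<omega>" "\<lambda>_. count_space UNIV" for \<omega>
  by (rule Ionescu_Tulcea_walk)

lemma space_path_space [simp]: "space path_space = UNIV"
  by (simp add: path_space_def space_PiM)

lemma sets_quenched [simp, measurable_cong]: "sets (quenched \<omega>) = sets path_space"
  by (simp add: quenched_def path_space_def)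

lemma space_quenched [simp]: "space (quenched \<omega>) = UNIV"
  using sets_eq_imp_space_eq[OF sets_quenched] by simp

lemma sets_singleton_fin: "finite J \<Longrightarrow> w \<in> extensional J \<Longrightarrow>
    {w} \<in> sets (Pi\<^sub>M J (\<lambda>_. count_space (UNIV :: int set)))"
  using sets_PiM_I_finite[of J "\<lambda>i. {w i}" "\<lambda>_. count_space UNIV"]
  by (auto simp: PiE_singleton)

lemma emeasure_walk_C:
  "emeasure (walk.C \<omega> 0 n (\<lambda>x. undefined)) {restrict w {0..<n}} =
     ennreal (\<Prod>i<n. measure (walk_kernel \<omega> i w) {w i})"
proof (induction n)
  case 0
  show ?case by (simp add: PiM_empty)
next
  case (Suc n)
  let ?M = "\<lambda>J. Pi\<^sub>M J (\<lambda>_. count_space (UNIV :: int set))"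
  let ?C = "walk.C \<omega> 0 n (\<lambda>x. undefined)"
  let ?w = "restrict w {0..<n}"
  let ?W = "{restrict w {0..<Suc n}}"
  have W: "?W \<in> sets (?M {0..<Suc n})" and w: "{?w} \<in> sets (?M {0..<n})"
    by (auto intro!: sets_singleton_fin simp del: restrict_apply)
  have sp: "space ?C = space (?M {0..<n})"
    using walk.space_C[of "\<lambda>x. undefined" 0] by (simp add: PiM_empty)
  have st: "sets ?C = sets (?M {0..<n})"
    using walk.sets_C[of "\<lambda>x. undefined" 0] by (simp add: PiM_empty)
  have k: "walk_kernel \<omega> n ?w = walk_kernel \<omega> n w"
    by (auto simp: walk_kernel_def split: nat.split)
  have "emeasure (walk.C \<omega> 0 (Suc n) (\<lambda>x. undefined)) ?W =
      (\<integral>\<^sup>+ x. emeasure (walk.eP \<omega> n x) ?W \<partial>?C)"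
    using walk.measurable_eP[of \<omega> n] W
    by (simp del: restrict_apply,
        subst emeasure_bind[where N = "?M {0..<Suc n}"])
       (auto simp: sp space_PiM_empty_iff measurable_cong_sets[OF st refl])
  also have "\<dots> = (\<integral>\<^sup>+ x. emeasure (walk_kernel \<omega> n w) {w n} * indicator {?w} x \<partial>?C)"
  proof (rule nn_integral_cong)
    fix x assume "x \<in> space ?C"
    then have x: "x \<in> space (?M {0..<n})" by (simp add: sp)
    then have xe: "x \<in> extensional {0..<n}" by (auto simp: space_PiM PiE_def)
    have "fun_upd x n -` ?W = (if x = ?w then {w n} else {})"
    proof (cases "x = ?w")
      case True
      then show ?thesis by (auto simp: fun_eq_iff restrict_def less_Suc_eq split: if_splits)
    next
      case False
      then obtain i where i: "x i \<noteq> ?w i" by (meson ext)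
      then have "i < n" using xe by (auto simp: extensional_def restrict_def split: if_splits)
      with i have "fun_upd x n y i \<noteq> restrict w {0..<Suc n} i" for y by simp
      then have "fun_upd x n y \<noteq> restrict w {0..<Suc n}" for y by metis
      with False show ?thesis by auto
    qed
    then show "emeasure (walk.eP \<omega> n x) ?W = emeasure (walk_kernel \<omega> n w) {w n} * indicator {?w} x"
      using walk.emeasure_eP[OF x W, of \<omega>] k by (auto simp del: restrict_apply)
  qed
  also have "\<dots> = emeasure (walk_kernel \<omega> n w) {w n} * emeasure ?C {?w}"
    using w by (subst nn_integral_cmult_indicator) (auto simp: st)
  also have "\<dots> = ennreal (\<Prod>i<Suc n. measure (walk_kernel \<omega> i w) {w i})"
    by (simp add: Suc.IH walk_kernel_def measure_pmf.emeasure_eq_measure ennreal_mult' prod_nonneg mult.commute)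
  finally show ?case .
qed

lemma emeasure_quenched_kernel:
  "emeasure (quenched \<omega>) {x. \<forall>i<n. x i = w i} =
     ennreal (\<Prod>i<n. measure (walk_kernel \<omega> i w) {w i})"
proof -
  let ?M = "\<lambda>_. count_space (UNIV :: int set)"
  let ?W = "{restrict w {0..<n}}"
  have W: "?W \<in> sets (Pi\<^sub>M {0..<n} ?M)" by (auto intro!: sets_singleton_fin simp del: restrict_apply)
  have "{x. \<forall>i<n. x i = w i} = prod_emb UNIV ?M {0..<n} ?W"
    by (auto simp: prod_emb_def space_PiM restrict_def fun_eq_iff split: if_splits)
  then have "emeasure (quenched \<omega>) {x. \<forall>i<n. x i = w i} = emeasure (walk.CI \<omega> {0..<n}) ?W"
    unfolding quenched_def using walk.lim[OF _ W] by simp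
  also have "\<dots> = emeasure (walk.C \<omega> 0 n (\<lambda>_. undefined)) ?W"
    using walk.emeasure_CI[OF order_refl W, of \<omega>] by (simp add: prod_emb_id W sets.sets_into_space)
  finally show ?thesis by (simp add: emeasure_walk_C)
qed

text \<open>The quenched law is that of the Markov chain started at \<open>0\<close> with transition law \<open>step_pmf\<close>.\<close>

lemma emeasure_quenched_cylinder:
  "emeasure (quenched \<omega>) {x. \<forall>i\<le>n. x i = w i} =
     (if w 0 = 0 then ennreal (\<Prod>i<n. pmf (step_pmf \<omega> (w i)) (w (Suc i))) else 0)"
  using emeasure_quenched_kernel[of \<omega> "Suc n" w]
  by (simp add: less_Suc_eq_le prod.lessThan_Suc_shift walk_kernel_def measure_pmf_single del: prod.lessThan_Suc)


lemma sets_path_space_cylinders: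
  "sets path_space = sigma_sets UNIV (insert {} (range (\<lambda>(n, w). {x. \<forall>i<n::nat. x i = w i})))"
    (is "_ = sigma_sets UNIV ?G")
proof
  have "{x. \<forall>i<n. x i = w i} \<in> sets path_space" for n :: nat and w :: "nat \<Rightarrow> int"
  proof -
    have "{x \<in> space path_space. \<forall>i<n. x i = w i} \<in> sets path_space"
      unfolding path_space_def by measurable
    then show ?thesis by simp
  qed
  then show "sigma_sets UNIV ?G \<subseteq> sets path_space"
    by (intro sets.sigma_sets_subset[of ?G path_space, simplified]) auto
  have "{f. f i \<in> A} \<in> sigma_sets UNIV ?G" for i :: nat and A :: "int set"
  proof -
    let ?c = "\<lambda>l. {x. \<forall>j<Suc i. x j = (l ! j :: int)}"
    let ?L = "{l. length l = Suc i \<and> l ! i \<in> A}"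
    have "{f. f i \<in> A} = (\<Union>l\<in>?L. ?c l)"
    proof (intro set_eqI iffI)
      fix f assume "f \<in> {f. f i \<in> A}"
      then show "f \<in> (\<Union>l\<in>?L. ?c l)"
        by (intro UN_I[of "map f [0..<Suc i]"]) (auto simp del: upt_Suc)
    qed auto
    also have "\<dots> \<in> sigma_sets UNIV ?G"
      by (rule sigma_sets_UNION) (auto intro!: sigma_sets.Basic image_eqI[of _ _ "(Suc i, (!) l)" for l])
    finally show ?thesis .
  qed
  then show "sets path_space \<subseteq> sigma_sets UNIV ?G"
    unfolding path_space_def sets_PiM_single
    by (simp, intro sigma_sets_mono) auto
qed

lemma prob_space_quenched: "prob_space (quenched \<omega>)"
  using emeasure_quenched_kernel[of \<omega> 0] by (intro prob_spaceI) simp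

lemma measurable_lam [measurable]: "(\<lambda>e. lam e k) \<in> borel_measurable seq_space"
proof -
  have "(\<lambda>e. fst (e k)) \<in> measurable seq_space (restrict_space borel {0<..<1::real})"
    unfolding seq_space_def mark_space_def by measurable
  then show ?thesis
    unfolding lam_def by (auto simp: measurable_restrict_space2_iff)
qed

lemma measurable_gap [measurable]: "(\<lambda>e. gap e k) \<in> measurable seq_space (count_space UNIV)"
proof -
  have "(\<lambda>e. snd (e k)) \<in> measurable seq_space (count_space {1::nat..})"
    unfolding seq_space_def mark_space_def by measurable
  then show ?thesis
    unfolding gap_def by (rule measurable_compose) simp
qed

lemma measurable_site [measurable]: "(\<lambda>e. site e k) \<in> measurable seq_space (count_space UNIV)"
proof -
  have [measurable]: "(\<lambda>e. \<Sum>k\<in>A. int (gap e k)) \<in> measurable seq_space (count_space UNIV)"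
    if "finite A" for A
    using that
  proof (induction A)
    case (insert a A)
    note insert.IH [measurable]
    show ?case using insert.hyps by simp
  qed simp
  show ?thesis by (cases "0 \<le> k") (simp_all add: site_def)
qed

lemma gap_pos: "e \<in> space seq_space \<Longrightarrow> 1 \<le> gap e k"
  by (auto simp: seq_space_def mark_space_def gap_def space_PiM PiE_def Pi_def space_pair_measure
        space_restrict_space mem_Times_iff)

lemma lam_bounds: "e \<in> space seq_space \<Longrightarrow> 0 < lam e k \<and> lam e k < 1"
  by (auto simp: seq_space_def mark_space_def lam_def space_PiM PiE_def Pi_def space_pair_measure
        space_restrict_space mem_Times_iff)

lemma site_0 [simp]: "site e 0 = 0"
  by (simp add: site_def)

lemma site_step: "site e n - site e (n - 1) = int (gap e n)"
proof -
  consider "n \<ge> 1" | "n = 0" | "n < 0" by linarith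
  then show ?thesis
  proof cases
    case 1
    then have "{1..n} = insert n {1..n-1}" by auto
    with 1 show ?thesis by (simp add: site_def)
  next
    case 2
    then show ?thesis by (simp add: site_def)
  next
    case 3
    then have "{n..0} = insert n {n+1..0}" by auto
    with 3 show ?thesis by (simp add: site_def)
  qed
qed

lemma site_strict_mono: "e \<in> space seq_space \<Longrightarrow> strict_mono (site e)"
proof (rule strict_monoI)
  fix m n :: int assume e: "e \<in> space seq_space" and "m < n"
  from \<open>m < n\<close> show "site e m < site e n"
  proof (induction n rule: int_gr_induct)
    case base
    show ?case using site_step[of e "m + 1"] gap_pos[OF e, of "m + 1"] by simp
  next
    case (step n)
    then show ?case using site_step[of e "n + 1"] gap_pos[OF e, of "n + 1"] by simp
  qed
qed

lemma sparse_env_site: "e \<in> space seq_space \<Longrightarrow> sparse_env e (site e k) = lam e k"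
  by (auto simp: sparse_env_def strict_mono_eq[OF site_strict_mono])

lemma measurable_sparse_env [measurable]: "(\<lambda>e. sparse_env e n) \<in> borel_measurable seq_space"
proof -
  have [measurable]: "(\<lambda>e. THE k. site e k = n) \<in> measurable seq_space (count_space UNIV)"
  proof (rule measurable_THE[where I = UNIV])
    show "i = j" if "e \<in> space seq_space" "site e i = n" "site e j = n" for e i j
      using that strict_mono_eq[OF site_strict_mono[OF that(1)], of i j] by simp
  qed simp_all
  have [measurable]: "(\<lambda>e. lam e (THE k. site e k = n)) \<in> borel_measurable seq_space"
    by (rule measurable_compose_countable[where f = "\<lambda>k e. lam e k"]) measurable
  show ?thesis unfolding sparse_env_def by measurable
qed

lemma measurable_quenched [measurable]:
  "(\<lambda>e. quenched (sparse_env e)) \<in> measurable seq_space (subprob_algebra path_space)"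
proof -
  have p: "(\<lambda>e. pmf (step_pmf (sparse_env e) i) j) \<in> borel_measurable seq_space" for i j
  proof -
    have "pmf (step_pmf \<omega> i) j =
        (if j = i + 1 then min 1 (max 0 (\<omega> i)) else if j = i - 1 then 1 - min 1 (max 0 (\<omega> i)) else 0)"
      for \<omega>
    proof -
      have "pmf (step_pmf \<omega> i) j =
          measure (measure_pmf (bernoulli_pmf (\<omega> i))) ((\<lambda>b. if b then i + 1 else i - 1) -` {j})"
        by (simp add: step_pmf_def pmf_map)
      also have "(\<lambda>b. if b then i + 1 else i - 1) -` {j} =
          (if j = i + 1 then {True} else if j = i - 1 then {False} else {})"
        by (auto split: if_splits)
      also have "measure (measure_pmf (bernoulli_pmf (\<omega> i))) \<dots> =
          (if j = i + 1 then pmf (bernoulli_pmf (\<omega> i)) True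
           else if j = i - 1 then pmf (bernoulli_pmf (\<omega> i)) False else 0)"
        by (simp add: measure_pmf_single)
      finally show ?thesis by (simp add: bernoulli_pmf.rep_eq)
    qed
    then show ?thesis by simp
  qed
  have q: "(\<lambda>e. measure (walk_kernel (sparse_env e) i w) {w i}) \<in> borel_measurable seq_space" for i w
    by (cases i) (simp_all add: walk_kernel_def measure_pmf_single p)
  show ?thesis
  proof (rule measurable_prob_algebraD[OF measurable_prob_algebra_generated[OF sets_path_space_cylinders]])
    let ?G = "insert {} (range (\<lambda>(n, w). {x. \<forall>i<n::nat. x i = (w i :: int)}))"
    show "Int_stable ?G"
    proof (rule Int_stableI)
      fix A B assume AB: "A \<in> ?G" "B \<in> ?G"
      have *: "{x. \<forall>i<n. x i = v i} \<inter> {x. \<forall>i<m. x i = w i} \<in> ?G"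
        for n m :: nat and v w :: "nat \<Rightarrow> int"
      proof (cases "\<forall>i<min n m. v i = w i")
        case True
        then have "{x. \<forall>i<n. x i = v i} \<inter> {x. \<forall>i<m. x i = w i} =
            {x. \<forall>i<max n m. x i = (if i < n then v i else w i)}"
          by (auto simp: less_max_iff_disj)
        then show ?thesis by (auto intro!: image_eqI[of _ _ "(max n m, \<lambda>i. if i < n then v i else w i)"])
      next
        case False
        then have "{x. \<forall>i<n. x i = v i} \<inter> {x. \<forall>i<m. x i = w i} = {}" by auto
        then show ?thesis by simp
      qed
      show "A \<inter> B \<in> ?G"
      proof (cases "A = {} \<or> B = {}")
        case False
        then obtain n v m w where "A = {x. \<forall>i<n. x i = v i}" "B = {x. \<forall>i<m. x i = w i}"
          using AB by auto
        then show ?thesis by (simp only: *)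
      qed auto
    qed
    show "(\<lambda>e. emeasure (quenched (sparse_env e)) A) \<in> borel_measurable seq_space" if "A \<in> ?G" for A
      using that by (auto simp: emeasure_quenched_kernel intro!: measurable_compose[OF _ measurable_ennreal] borel_measurable_prod q)
  qed (auto simp: prob_space_quenched)
qed

lemma
  assumes P: "prob_space P" and sets_P: "sets P = sets seq_space"
  shows sets_annealed: "sets (annealed P) = sets (P \<Otimes>\<^sub>M path_space)"
    and prob_space_annealed: "prob_space (annealed P)"
    and emeasure_annealed_times: "F \<in> sets P \<Longrightarrow> G \<in> sets path_space \<Longrightarrow>
      emeasure (annealed P) (F \<times> G) = (\<integral>\<^sup>+ e\<in>F. emeasure (quenched (sparse_env e)) G \<partial>P)"
proof -
  interpret P: prob_space P by fact
  let ?K = "\<lambda>e. distr (quenched (sparse_env e)) (P \<Otimes>\<^sub>M path_space) (Pair e)"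
  have [measurable]: "(\<lambda>e. quenched (sparse_env e)) \<in> measurable P (subprob_algebra path_space)"
    using measurable_quenched by (simp add: measurable_cong_sets[OF sets_P refl])
  have K[measurable]: "?K \<in> measurable P (subprob_algebra (P \<Otimes>\<^sub>M path_space))"
    by (rule measurable_distr2[where M = path_space]) measurable
  show "sets (annealed P) = sets (P \<Otimes>\<^sub>M path_space)"
    unfolding annealed_def by (rule sets_bind) (simp_all add: P.not_empty)
  have Pair_q: "Pair e \<in> measurable (quenched (sparse_env e)) (P \<Otimes>\<^sub>M path_space)" if "e \<in> space P" for e
    using measurable_Pair1'[OF that, of path_space] by (simp add: measurable_cong_sets[OF sets_quenched refl])
  show "prob_space (annealed P)"
    unfolding annealed_def
    by (rule P.prob_space_bind[OF _ K])
       (auto intro!: AE_I2 prob_space.prob_space_distr prob_space_quenched Pair_q)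
  assume F: "F \<in> sets P" and G: "G \<in> sets path_space"
  then have FG: "F \<times> G \<in> sets (P \<Otimes>\<^sub>M path_space)" by simp
  have "emeasure (annealed P) (F \<times> G) = (\<integral>\<^sup>+ e. emeasure (?K e) (F \<times> G) \<partial>P)"
    unfolding annealed_def by (rule emeasure_bind[OF P.not_empty K FG])
  also have "\<dots> = (\<integral>\<^sup>+ e\<in>F. emeasure (quenched (sparse_env e)) G \<partial>P)"
  proof (rule nn_integral_cong)
    fix e assume e: "e \<in> space P"
    have "Pair e -` (F \<times> G) = (if e \<in> F then G else {})" by auto
    then show "emeasure (?K e) (F \<times> G) = emeasure (quenched (sparse_env e)) G * indicator F e"
      by (simp add: emeasure_distr[OF Pair_q[OF e] FG])
  qed
  finally show "emeasure (annealed P) (F \<times> G) =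
    (\<integral>\<^sup>+ e\<in>F. emeasure (quenched (sparse_env e)) G \<partial>P)" .
qed

end

theory Submission
  imports Defs
begin

text \<open>
  Given the environment, the walk has a strictly increasing harmonic function \<open>h\<close> (called \<open>scale\<close> below),
  whose increment over the block from \<open>a\<^sub>k\<close> to \<open>a\<^sub>k\<^sub>+\<^sub>1\<close> is \<open>d\<^sub>k\<^sub>+\<^sub>1 exp (V k)\<close>, where the potential \<open>V\<close> has
  increments \<open>ln \<xi>\<^sub>k\<close>. If \<open>h\<close> is unbounded below, a bounded function that is harmonic to the left of \<open>N\<close> is
  constant there, so the walk reaches every \<open>N\<close>; if moreover \<open>h\<close> is bounded above, the walk tends to
  infinity. The other side follows by reflection.

  Whether \<open>h\<close> is bounded is read off the potential. A nonzero mean of \<open>ln \<xi>\<^sub>0\<close> gives \<open>V\<close> a linear drift, and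
  integrability of \<open>ln d\<^sub>0\<close> makes the gaps subexponential, so that \<open>h\<close> is bounded on the side where \<open>V\<close> drifts
  to minus infinity. If the mean is zero, \<open>V\<close> tends to minus infinity on neither side and \<open>h\<close> is unbounded
  on both.
\<close>

section \<open>Birkhoff sums of ergodic systems\<close>

lemma filterlim_const_add_at_bot_iff:
  fixes s :: "'a \<Rightarrow> real"
  shows "filterlim (\<lambda>n. a + s n) at_bot F \<longleftrightarrow> filterlim s at_bot F"
proof -
  have *: "filterlim (\<lambda>n. b + t n) at_bot F" if "filterlim t at_bot F" for b and t :: "'a \<Rightarrow> real"
    unfolding filterlim_at_bot
  proof
    fix Z show "eventually (\<lambda>n. b + t n \<le> Z) F"
      using that[unfolded filterlim_at_bot, rule_format, of "Z - b"] by eventually_elim simp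
  qed
  show ?thesis using *[of s a] *[of "\<lambda>n. a + s n" "- a"] by auto
qed

text \<open>The map need not be invertible: the locale is used once for the shift and once for its
  inverse, one for each half-line. Ergodicity concerns strictly invariant sets, so the events below
  are shown to be invariant exactly and not only up to null sets.\<close>

locale ergodic_system = prob_space +
  fixes T :: "'a \<Rightarrow> 'a"
  assumes T_measurable [measurable]: "T \<in> measurable M M"
    and T_preserving: "distr M M T = M"
    and T_ergodic: "\<And>A. A \<in> sets M \<Longrightarrow> T -` A \<inter> space M = A \<Longrightarrow> prob A = 0 \<or> prob A = 1"
begin

abbreviation birkhoff_sum :: "('a \<Rightarrow> real) \<Rightarrow> nat \<Rightarrow> 'a \<Rightarrow> real" where
  "birkhoff_sum f n x \<equiv> (\<Sum>j<n. f ((T ^^ j) x))"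

text \<open>The maximum of the Birkhoff sums of length 0 to \<open>n\<close>, written as the
  recursion on which Garsia's proof of the maximal ergodic theorem rests.\<close>

primrec birkhoff_max :: "('a \<Rightarrow> real) \<Rightarrow> nat \<Rightarrow> 'a \<Rightarrow> real" where
  "birkhoff_max f 0 x = 0"
| "birkhoff_max f (Suc n) x = max 0 (f x + birkhoff_max f n (T x))"

lemma T_space: "x \<in> space M \<Longrightarrow> T x \<in> space M"
  by (rule measurable_space[OF T_measurable])

lemma funpow_measurable [measurable]: "T ^^ n \<in> measurable M M"
  by (induction n) (auto intro: measurable_comp)

lemma funpow_preserving: "distr M M (T ^^ n) = M"
proof (induction n)
  case (Suc n)
  have "distr M M (T ^^ Suc n) = distr (distr M M (T ^^ n)) M T"
    by (subst distr_distr) (auto simp: comp_def)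
  then show ?case unfolding Suc T_preserving .
qed (simp add: distr_id)

lemma AE_funpow: "AE x in M. Q x \<Longrightarrow> AE x in M. Q ((T ^^ n) x)"
  using AE_distrD[OF funpow_measurable[of n], where P = Q] unfolding funpow_preserving .

lemma nn_integral_T:
  assumes [measurable]: "f \<in> borel_measurable M"
  shows "(\<integral>\<^sup>+ x. f (T x) \<partial>M) = (\<integral>\<^sup>+ x. f x \<partial>M)"
  using nn_integral_distr[OF T_measurable, of f] by (simp add: T_preserving)

lemma integral_T:
  fixes f :: "'a \<Rightarrow> real"
  assumes [measurable]: "f \<in> borel_measurable M"
  shows "(\<integral> x. f (T x) \<partial>M) = (\<integral> x. f x \<partial>M)"
  using integral_distr[OF T_measurable, of f] by (simp add: T_preserving)

lemma integrable_T:
  fixes f :: "'a \<Rightarrow> real"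
  shows "integrable M f \<Longrightarrow> integrable M (\<lambda>x. f (T x))"
  using integrable_distr[OF T_measurable, of f] by (simp add: T_preserving)

lemma birkhoff_sum_Suc: "birkhoff_sum f (Suc n) x = f x + birkhoff_sum f n (T x)"
  by (simp add: sum.lessThan_Suc_shift funpow_swap1 del: sum.lessThan_Suc funpow.simps)
     (simp add: funpow_Suc_right del: funpow.simps)

lemma birkhoff_max_nonneg: "0 \<le> birkhoff_max f n x"
  by (cases n) auto

lemma birkhoff_max_mono_Suc: "birkhoff_max f n x \<le> birkhoff_max f (Suc n) x"
proof (induction n arbitrary: x)
  case (Suc n)
  show ?case using Suc[of "T x"] by simp
qed simp

lemma birkhoff_max_mono: "incseq (\<lambda>n. birkhoff_max f n x)"
  by (rule incseq_SucI) (rule birkhoff_max_mono_Suc)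

lemma birkhoff_sum_le_max: "birkhoff_sum f n x \<le> birkhoff_max f n x"
proof (induction n arbitrary: x)
  case (Suc n)
  show ?case unfolding birkhoff_sum_Suc using Suc[of "T x"] by simp
qed simp

lemma birkhoff_max_le:
  "(\<And>k. birkhoff_sum f k x \<le> C) \<Longrightarrow> birkhoff_max f n x \<le> C"
proof (induction n arbitrary: x C)
  case 0
  from 0[of 0] show ?case by simp
next
  case (Suc n)
  have "birkhoff_max f n (T x) \<le> C - f x"
  proof (rule Suc.IH)
    fix k show "birkhoff_sum f k (T x) \<le> C - f x"
      using Suc.prems[of "Suc k"] unfolding birkhoff_sum_Suc by simp
  qed
  moreover have "0 \<le> C" using Suc.prems[of 0] by simp
  ultimately show ?case by simp
qed

lemma birkhoff_max_measurable [measurable]: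
  assumes [measurable]: "f \<in> borel_measurable M"
  shows "birkhoff_max f n \<in> borel_measurable M"
proof (induction n)
  case (Suc n)
  note Suc [measurable]
  have "(\<lambda>x. max 0 (f x + birkhoff_max f n (T x))) \<in> borel_measurable M" by measurable
  then show ?case by simp
qed simp

lemma integrable_birkhoff_max:
  assumes [simp]: "integrable M f"
  shows "integrable M (birkhoff_max f n)"
proof (induction n)
  case (Suc n)
  have "integrable M (\<lambda>x. max 0 (f x + birkhoff_max f n (T x)))"
    using integrable_T[OF Suc] by (intro integrable_max) auto
  then show ?case by simp
qed simp

text \<open>
  On the invariant set where the maxima are unbounded, \<open>birkhoff_max f (Suc n) - birkhoff_max f n \<circ> T\<close>
  tends to \<open>f\<close>, and its integral is nonnegative.
\<close>

lemma AE_birkhoff_sum_bounded: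
  assumes f: "integrable M f" and neg: "integral\<^sup>L M f < 0"
  shows "AE x in M. \<exists>C. \<forall>n. birkhoff_sum f n x \<le> C"
proof -
  note [measurable] = borel_measurable_integrable[OF f]
  \<comment> \<open>Natural thresholds make this a countable intersection, hence measurable;
    \<open>unbounded_iff\<close> returns to real thresholds.\<close>
  define A where "A = {x \<in> space M. \<forall>m::nat. \<exists>n. real m < birkhoff_max f n x}"
  have A [measurable]: "A \<in> sets M" unfolding A_def by measurable
  have unbounded_iff: "(\<forall>m::nat. \<exists>n. real m < birkhoff_max f n x) \<longleftrightarrow> (\<forall>C. \<exists>n. C < birkhoff_max f n x)" for x
    by (meson reals_Archimedean2 order_less_trans)
  have inv: "(\<forall>C. \<exists>n. C < birkhoff_max f n (T x)) \<longleftrightarrow> (\<forall>C. \<exists>n. C < birkhoff_max f n x)" for x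
  proof (intro iffI allI)
    fix C assume "\<forall>C. \<exists>n. C < birkhoff_max f n (T x)"
    then obtain n where "C - f x < birkhoff_max f n (T x)" by blast
    then have "C < birkhoff_max f (Suc n) x" by simp
    then show "\<exists>n. C < birkhoff_max f n x" by blast
  next
    fix C assume "\<forall>C. \<exists>n. C < birkhoff_max f n x"
    \<comment> \<open>A threshold of at least 0 rules out \<open>n = 0\<close> and the branch where
      the maximum is 0.\<close>
    then obtain n where n: "max 0 (C + f x) < birkhoff_max f n x" by blast
    then obtain k where "n = Suc k" by (cases n) auto
    with n have "C < birkhoff_max f k (T x)" by (auto simp: max_def split: if_splits)
    then show "\<exists>n. C < birkhoff_max f n (T x)" by blast
  qed
  have "T -` A \<inter> space M = A"
    unfolding A_def unbounded_iff using inv T_space by auto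
  then consider "prob A = 0" | "prob A = 1" using T_ergodic[OF A] by blast
  then show ?thesis
  proof cases
    case 1
    then have "AE x in M. x \<notin> A" using A by (simp add: prob_eq_0)
    then show ?thesis
    proof (rule AE_mp, intro AE_I2 impI)
      fix x assume "x \<in> space M" "x \<notin> A"
      then obtain C where "\<forall>n. birkhoff_max f n x \<le> C"
        by (auto simp: A_def not_less)
      then show "\<exists>C. \<forall>n. birkhoff_sum f n x \<le> C"
        using birkhoff_sum_le_max order_trans by blast
    qed
  next
    case 2
    let ?d = "\<lambda>n x. birkhoff_max f (Suc n) x - birkhoff_max f n (T x)"
    have A_AE: "AE x in M. x \<in> A" using 2 A by (simp add: prob_eq_1)
    have "(\<lambda>n. integral\<^sup>L M (?d n)) \<longlonglongrightarrow> integral\<^sup>L M f"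
    proof (rule integral_dominated_convergence[where w = "\<lambda>x. \<bar>f x\<bar>"])
      show "AE x in M. (\<lambda>n. ?d n x) \<longlonglongrightarrow> f x"
        using A_AE
      proof (rule AE_mp, intro AE_I2 impI)
        fix x assume "x \<in> A"
        then have "\<forall>C. \<exists>n. C < birkhoff_max f n (T x)"
          unfolding A_def unbounded_iff inv by simp
        then obtain n0 where n0: "- f x < birkhoff_max f n0 (T x)" by blast
        have "?d n x = f x" if "n \<ge> n0" for n
          using incseqD[OF birkhoff_max_mono that, of f "T x"] n0 by simp
        then have "eventually (\<lambda>n. ?d n x = f x) sequentially"
          by (auto simp: eventually_sequentially)
        then show "(\<lambda>n. ?d n x) \<longlonglongrightarrow> f x"
          by (rule tendsto_eventually)
      qed
      \<comment> \<open>With \<open>m = birkhoff_max f n (T x)\<close>, which is nonnegative, the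
        difference equals \<open>max (- m) (f x)\<close>.\<close>
      show "AE x in M. norm (?d n x) \<le> \<bar>f x\<bar>" for n
        proof (rule AE_I2)
        fix x show "norm (?d n x) \<le> \<bar>f x\<bar>"
          using birkhoff_max_nonneg[of f n "T x"] by (auto simp: max_def)
      qed
    qed (use f in auto)
    moreover have "integral\<^sup>L M (?d n) \<ge> 0" for n
    proof -
      have i: "integrable M (birkhoff_max f k)" for k by (rule integrable_birkhoff_max[OF f])
      have "integral\<^sup>L M (?d n) = integral\<^sup>L M (birkhoff_max f (Suc n)) - integral\<^sup>L M (birkhoff_max f n)"
        using integral_T[of "birkhoff_max f n"] i[of "Suc n"] integrable_T[OF i[of n]]
        by (simp del: birkhoff_max.simps)
      moreover have "integral\<^sup>L M (birkhoff_max f n) \<le> integral\<^sup>L M (birkhoff_max f (Suc n))"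
        by (intro integral_mono i birkhoff_max_mono_Suc)
      ultimately show ?thesis by simp
    qed
    ultimately have "0 \<le> integral\<^sup>L M f"
      by (intro LIMSEQ_le_const[where X = "\<lambda>n. integral\<^sup>L M (?d n)"]) auto
    with neg show ?thesis by simp
  qed
qed

text \<open>Adding half of the drift to \<open>f\<close> leaves the mean negative, so the sums of
  \<open>f + c\<close> are still bounded above.\<close>

lemma AE_birkhoff_sum_linear:
  assumes f: "integrable M f" and neg: "integral\<^sup>L M f < 0"
  shows "AE x in M. \<exists>C c. 0 < c \<and> (\<forall>n. birkhoff_sum f n x \<le> C - c * real n)"
proof -
  define c where "c = - integral\<^sup>L M f / 2"
  have c: "0 < c" using neg by (simp add: c_def)
  have "AE x in M. \<exists>C. \<forall>n. birkhoff_sum (\<lambda>x. f x + c) n x \<le> C"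
    using f neg by (intro AE_birkhoff_sum_bounded) (simp_all add: prob_space c_def)
  then show ?thesis
  proof (rule AE_mp, intro AE_I2 impI)
    fix x assume "\<exists>C. \<forall>n. birkhoff_sum (\<lambda>x. f x + c) n x \<le> C"
    then obtain C where "\<forall>n. birkhoff_sum (\<lambda>x. f x + c) n x \<le> C" by blast
    then have "\<forall>n. birkhoff_sum f n x \<le> C - c * real n"
      by (simp add: sum.distrib algebra_simps)
    with c show "\<exists>C c. 0 < c \<and> (\<forall>n. birkhoff_sum f n x \<le> C - c * real n)" by blast
  qed
qed

text \<open>\<open>G\<close> itself need not be integrable, so the integral is computed from the truncations of \<open>G\<close>.\<close>

lemma integral_coboundary_zero:
  fixes G :: "'a \<Rightarrow> real"
  assumes [measurable]: "G \<in> borel_measurable M"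
    and H: "integrable M (\<lambda>x. G x - G (T x))"
    and nonneg: "\<And>x. x \<in> space M \<Longrightarrow> 0 \<le> G x"
  shows "integral\<^sup>L M (\<lambda>x. G x - G (T x)) = 0"
proof -
  let ?t = "\<lambda>k x. min (G x) (real k)"
  have i: "integrable M (?t k)" for k
    by (rule integrable_const_bound[where B = "real k"]) (use nonneg in \<open>auto simp: min_def\<close>)
  \<comment> \<open>Truncation at \<open>k\<close> is 1-Lipschitz, so the truncated differences are
    dominated by the untruncated one.\<close>
  have "(\<lambda>k. integral\<^sup>L M (\<lambda>x. ?t k x - ?t k (T x))) \<longlonglongrightarrow> integral\<^sup>L M (\<lambda>x. G x - G (T x))"
  proof (rule integral_dominated_convergence[where w = "\<lambda>x. \<bar>G x - G (T x)\<bar>"])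
    show "AE x in M. (\<lambda>k. ?t k x - ?t k (T x)) \<longlonglongrightarrow> G x - G (T x)"
    proof (intro AE_I2 tendsto_diff)
      have *: "(\<lambda>k. min a (real k)) \<longlonglongrightarrow> a" for a :: real
      proof (rule tendsto_eventually)
        obtain k0 where "a \<le> real k0" using real_arch_simple by blast
        then show "eventually (\<lambda>k. min a (real k) = a) sequentially"
          by (auto simp: eventually_sequentially min_def intro!: exI[of _ k0])
      qed
      show "(\<lambda>k. ?t k x) \<longlonglongrightarrow> G x" "(\<lambda>k. ?t k (T x)) \<longlonglongrightarrow> G (T x)" for x
        by (rule *)+
    qed
    show "integrable M (\<lambda>x. \<bar>G x - G (T x)\<bar>)" using H by (rule integrable_abs)
  qed (auto simp: min_def)
  moreover have "integral\<^sup>L M (\<lambda>x. ?t k x - ?t k (T x)) = 0" for k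
    using integral_T[of "?t k"] i[of k] integrable_T[OF i[of k]] by simp
  ultimately show ?thesis
    by (simp add: LIMSEQ_const_iff)
qed

text \<open>
  If the Birkhoff sums of \<open>f\<close> drift to minus infinity, their maximum \<open>G\<close> is finite and satisfies
  \<open>G = max 0 (f + G \<circ> T)\<close>. As \<open>f\<close> has mean zero this forces \<open>f = G - G \<circ> T\<close>, so that the Birkhoff sum
  \<open>G - G \<circ> T\<^sup>n\<close> is tight.
\<close>

lemma AE_birkhoff_sum_not_at_bot:
  assumes f: "integrable M f" and zero: "integral\<^sup>L M f = 0"
  shows "AE x in M. \<not> filterlim (\<lambda>n. birkhoff_sum f n x) at_bot sequentially"
proof -
  note [measurable] = borel_measurable_integrable[OF f]
  define B where "B = {x \<in> space M. \<forall>m::nat. \<exists>N. \<forall>n\<ge>N. birkhoff_sum f n x \<le> - real m}"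
  have B [measurable]: "B \<in> sets M" unfolding B_def by measurable
  have B_iff: "(\<forall>m::nat. \<exists>N. \<forall>n\<ge>N. birkhoff_sum f n x \<le> - real m) \<longleftrightarrow>
      filterlim (\<lambda>n. birkhoff_sum f n x) at_bot sequentially" for x
  proof -
    have "\<exists>m::nat. - real m \<le> Z" for Z
      using real_arch_simple[of "- Z"] by (auto simp: minus_le_iff)
    then show ?thesis
      unfolding filterlim_at_bot eventually_sequentially by (meson order_trans)
  qed
  have inv: "filterlim (\<lambda>n. birkhoff_sum f n (T x)) at_bot sequentially \<longleftrightarrow>
      filterlim (\<lambda>n. birkhoff_sum f n x) at_bot sequentially" for x
  proof -
    have "filterlim (\<lambda>n. birkhoff_sum f n x) at_bot sequentially \<longleftrightarrow>
        filterlim (\<lambda>n. birkhoff_sum f (Suc n) x) at_bot sequentially"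
      by (rule filterlim_sequentially_Suc[symmetric])
    also have "\<dots> \<longleftrightarrow> filterlim (\<lambda>n. f x + birkhoff_sum f n (T x)) at_bot sequentially"
      unfolding birkhoff_sum_Suc ..
    also have "\<dots> \<longleftrightarrow> filterlim (\<lambda>n. birkhoff_sum f n (T x)) at_bot sequentially"
      by (rule filterlim_const_add_at_bot_iff)
    finally show ?thesis ..
  qed
  have "T -` B \<inter> space M = B"
    unfolding B_def B_iff using inv T_space by auto
  then consider "prob B = 0" | "prob B = 1" using T_ergodic[OF B] by blast
  then show ?thesis
  proof cases
    case 1
    then have "AE x in M. x \<notin> B" using B by (simp add: prob_eq_0)
    then show ?thesis using AE_space by eventually_elim (auto simp: B_def B_iff)
  next
    case 2
    then have B_AE: "AE x in M. x \<in> B" using B by (simp add: prob_eq_1)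
    \<comment> \<open>\<open>lim\<close> is unspecified where the maxima diverge. Clipping at 0
      makes \<open>G'\<close> nonnegative everywhere, as \<open>integral_coboundary_zero\<close>
      requires, and changes nothing on \<open>B\<close>.\<close>
    define G where "G x = lim (\<lambda>n. birkhoff_max f n x)" for x
    define G' where "G' x = max 0 (G x)" for x
    have [measurable]: "G \<in> borel_measurable M"
      unfolding G_def[abs_def] by measurable
    then have [measurable]: "G' \<in> borel_measurable M" unfolding G'_def by measurable
    have G: "(\<lambda>n. birkhoff_max f n x) \<longlonglongrightarrow> G' x" if "x \<in> B" for x
    proof -
      from that have "filterlim (\<lambda>n. birkhoff_sum f n x) at_bot sequentially"
        unfolding B_def B_iff by simp
      then obtain N where N: "\<forall>n\<ge>N. birkhoff_sum f n x \<le> 0"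
        unfolding filterlim_at_bot eventually_sequentially by blast
      define C where "C = Max (insert 0 ((\<lambda>n. birkhoff_sum f n x) ` {..N}))"
      have "birkhoff_sum f n x \<le> C" for n
      proof (cases "n \<le> N")
        case True then show ?thesis unfolding C_def by (intro Max_ge) auto
      next
        case False
        then have "birkhoff_sum f n x \<le> 0" using N by simp
        also have "0 \<le> C" unfolding C_def by (intro Max_ge) auto
        finally show ?thesis .
      qed
      then have "\<forall>n. birkhoff_max f n x \<le> C" using birkhoff_max_le by blast
      then have "convergent (\<lambda>n. birkhoff_max f n x)"
        using birkhoff_max_mono[of f x] by (metis incseq_convergent convergentI)
      then have l: "(\<lambda>n. birkhoff_max f n x) \<longlonglongrightarrow> G x"
        unfolding G_def by (simp add: convergent_LIMSEQ_iff)
      then have "0 \<le> G x"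
        by (rule LIMSEQ_le_const) (use birkhoff_max_nonneg in auto)
      with l show ?thesis by (simp add: G'_def)
    qed
    have G_eq: "G' x = max 0 (f x + G' (T x))" if "x \<in> B" for x
    proof -
      have "T x \<in> B" using that \<open>T -` B \<inter> space M = B\<close> by auto
      then have "(\<lambda>n. birkhoff_max f (Suc n) x) \<longlonglongrightarrow> max 0 (f x + G' (T x))"
        unfolding birkhoff_max.simps by (intro tendsto_max tendsto_const tendsto_add G)
      moreover have "(\<lambda>n. birkhoff_max f (Suc n) x) \<longlonglongrightarrow> G' x"
        using G[OF that] by (rule LIMSEQ_Suc)
      ultimately show ?thesis using LIMSEQ_unique by blast
    qed
    have G_nonneg: "0 \<le> G' x" for x by (simp add: G'_def)
    \<comment> \<open>On \<open>B\<close> the recursion gives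
      \<open>?H x = max (- G' (T x)) (f x)\<close>. Hence \<open>?H\<close> lies above
      \<open>f\<close> and is dominated by \<open>\<bar>f\<bar>\<close>, although \<open>G'\<close>
      may fail to be integrable.\<close>
    let ?H = "\<lambda>x. G' x - G' (T x)"
    have H: "integrable M ?H"
    proof (rule Bochner_Integration.integrable_bound[OF f])
      show "AE x in M. norm (?H x) \<le> norm (f x)"
        using B_AE
      proof eventually_elim
        case (elim x)
        show ?case using G_eq[OF elim] G_nonneg[of "T x"] by (auto simp: max_def abs_if split: if_splits)
      qed
    qed simp
    have "integral\<^sup>L M (\<lambda>x. ?H x - f x) = 0"
      using integral_coboundary_zero[OF _ H] G_nonneg H f zero by simp
    moreover have "AE x in M. 0 \<le> ?H x - f x"
      using B_AE
    proof eventually_elim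
      case (elim x)
      show ?case using G_eq[OF elim] by simp
    qed
    ultimately have "AE x in M. ?H x - f x = 0"
      using integral_nonneg_eq_0_iff_AE[of M "\<lambda>x. ?H x - f x"] H f by simp
    then have "AE x in M. \<forall>n. ?H ((T ^^ n) x) - f ((T ^^ n) x) = 0"
      unfolding AE_all_countable using AE_funpow by blast
    then have lim: "AE x in M. filterlim (\<lambda>n. G' ((T ^^ n) x)) at_top sequentially"
      using B_AE
    proof eventually_elim
      case (elim x)
      have s: "birkhoff_sum f n x = G' x - G' ((T ^^ n) x)" for n
      proof (induction n)
        case (Suc n)
        show ?case using elim(1)[rule_format, of n] Suc by simp
      qed simp
      have "filterlim (\<lambda>n. birkhoff_sum f n x) at_bot sequentially"
        using elim(2) unfolding B_def B_iff by simp
      then have "filterlim (\<lambda>n. G' x - G' ((T ^^ n) x)) at_bot sequentially"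
        unfolding s .
      then have bot: "\<And>Z. eventually (\<lambda>n. G' x - G' ((T ^^ n) x) \<le> Z) sequentially"
        unfolding filterlim_at_bot by blast
      show ?case
        unfolding filterlim_at_top
      proof
        fix Z show "eventually (\<lambda>n. Z \<le> G' ((T ^^ n) x)) sequentially"
          using bot[of "G' x - Z"] by eventually_elim simp
      qed
    qed
    \<comment> \<open>By invariance \<open>G' ((T ^^ n) x)\<close> has the law of \<open>G'\<close>
      for every \<open>n\<close>, yet it tends to infinity. So \<open>G'\<close> exceeds every
      \<open>k\<close> almost surely, which no real-valued function does.\<close>
    have small: "prob {x \<in> space M. G' x \<le> real k} = 0" for k
    proof -
      let ?i = "indicator {x \<in> space M. G' x \<le> real k} :: 'a \<Rightarrow> real"
      have "(\<lambda>n. integral\<^sup>L M (\<lambda>x. ?i ((T ^^ n) x))) \<longlonglongrightarrow> integral\<^sup>L M (\<lambda>x. 0)"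
      proof (rule integral_dominated_convergence[where w = "\<lambda>x. 1"])
        show "AE x in M. (\<lambda>n. ?i ((T ^^ n) x)) \<longlonglongrightarrow> 0"
          using lim
        proof eventually_elim
          case (elim x)
          have "eventually (\<lambda>n. real k + 1 \<le> G' ((T ^^ n) x)) sequentially"
            using elim unfolding filterlim_at_top by blast
          then have "eventually (\<lambda>n. ?i ((T ^^ n) x) = 0) sequentially"
            by eventually_elim (auto simp: indicator_def)
          then show ?case by (rule tendsto_eventually)
        qed
      qed (auto simp: indicator_def)
      moreover have "integral\<^sup>L M (\<lambda>x. ?i ((T ^^ n) x)) = prob {x \<in> space M. G' x \<le> real k}" for n
        using integral_distr[OF funpow_measurable, of ?i n] by (simp add: funpow_preserving)
      ultimately show ?thesis by (simp add: LIMSEQ_const_iff)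
    qed
    then have "AE x in M. \<forall>k. \<not> G' x \<le> real k"
      unfolding AE_all_countable
      by (intro allI, subst (asm) prob_eq_0) auto
    then have "AE x in M. False"
      by eventually_elim (use real_arch_simple in blast)
    then show ?thesis by eventually_elim simp
  qed
qed

end

section \<open>Birkhoff sums with extended-valued means\<close>

context ergodic_system
begin

text \<open>
  The last term is absorbed into a Birkhoff sum: \<open>g \<circ> T\<^sup>n \<le> l + \<Sum>j<n. max 0 (g \<circ> T\<^sup>j\<^sup>+\<^sup>1 - l)\<close> for
  \<open>n > 0\<close>, and the summands have small mean if \<open>l\<close> is large.
\<close>

lemma AE_birkhoff_sum_plus_le_linear:
  fixes f g :: "'a \<Rightarrow> real"
  assumes [measurable]: "f \<in> borel_measurable M" "g \<in> borel_measurable M"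
    and f: "(\<integral>\<^sup>+ x. ennreal (f x) \<partial>M) < (\<integral>\<^sup>+ x. ennreal (- f x) \<partial>M)"
    and g: "\<And>x. x \<in> space M \<Longrightarrow> 0 \<le> g x" "(\<integral>\<^sup>+ x. ennreal (g x) \<partial>M) < \<infinity>"
  shows "AE x in M. \<exists>C c. 0 < c \<and> (\<forall>n. birkhoff_sum f n x + g ((T ^^ n) x) \<le> C - c * real n)"
proof -
  \<comment> \<open>The mean of \<open>f\<close> may be minus infinity. Cutting \<open>f\<close> off
    below at \<open>- real k\<close> makes it integrable, and by monotone convergence the mean is
    still negative for some \<open>k\<close>.\<close>
  have "(\<integral>\<^sup>+ x. ennreal (f x) \<partial>M) < (SUP k. \<integral>\<^sup>+ x. ennreal (min (- f x) (real k)) \<partial>M)"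
  proof -
    note f
    also have "(\<integral>\<^sup>+ x. ennreal (- f x) \<partial>M) = (\<integral>\<^sup>+ x. (SUP k. ennreal (min (- f x) (real k))) \<partial>M)"
    proof (rule nn_integral_cong)
      fix x
      obtain k0 where "- f x \<le> real k0" using real_arch_simple by blast
      then have "ennreal (- f x) \<le> (SUP k. ennreal (min (- f x) (real k)))"
        by (intro SUP_upper2[of k0]) auto
      then show "ennreal (- f x) = (SUP k. ennreal (min (- f x) (real k)))"
        by (intro antisym SUP_least ennreal_leI) auto
    qed
    also have "\<dots> = (SUP k. \<integral>\<^sup>+ x. ennreal (min (- f x) (real k)) \<partial>M)"
      by (rule nn_integral_monotone_convergence_SUP)
         (auto simp: incseq_def le_fun_def intro!: ennreal_leI)
    finally show ?thesis .
  qed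
  then obtain k where k: "(\<integral>\<^sup>+ x. ennreal (f x) \<partial>M) < (\<integral>\<^sup>+ x. ennreal (min (- f x) (real k)) \<partial>M)"
    unfolding less_SUP_iff by auto
  have fk: "integrable M (\<lambda>x. max (f x) (- real k))" "integral\<^sup>L M (\<lambda>x. max (f x) (- real k)) < 0"
  proof -
    let ?p = "\<lambda>x. max 0 (f x)" and ?m = "\<lambda>x. max 0 (min (- f x) (real k))"
    have max0: "ennreal (max 0 a) = ennreal a" for a by (simp add: max_def ennreal_neg)
    have p: "integrable M ?p"
      by (rule integrableI_nonneg) (use k in \<open>auto simp: max0 less_top[symmetric]\<close>)
    have m: "integrable M ?m"
      by (rule integrable_const_bound[where B = "real k"]) auto
    have "ennreal (integral\<^sup>L M ?p) < ennreal (integral\<^sup>L M ?m)"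
      using k nn_integral_eq_integral[OF p] nn_integral_eq_integral[OF m] by (simp add: max0)
    then have "integral\<^sup>L M ?p < integral\<^sup>L M ?m"
      by (simp add: ennreal_less_iff)
    moreover have eq: "max (f x) (- real k) = ?p x - ?m x" for x by (auto simp: max_def min_def)
    ultimately show "integrable M (\<lambda>x. max (f x) (- real k))" "integral\<^sup>L M (\<lambda>x. max (f x) (- real k)) < 0"
      unfolding eq using p m by auto
  qed
  have gi: "integrable M g"
    by (rule integrableI_nonneg) (use g in \<open>auto simp: less_top[symmetric]\<close>)
  have "(\<lambda>l. integral\<^sup>L M (\<lambda>x. max 0 (g x - real l))) \<longlonglongrightarrow> integral\<^sup>L M (\<lambda>x. 0)"
  proof (rule integral_dominated_convergence[where w = g])
    show "AE x in M. (\<lambda>l. max 0 (g x - real l)) \<longlonglongrightarrow> 0"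
    proof (rule AE_I2)
      fix x
      obtain l0 where "g x \<le> real l0" using real_arch_simple by blast
      then have "eventually (\<lambda>l. max 0 (g x - real l) = 0) sequentially"
        by (auto simp: eventually_sequentially intro!: exI[of _ l0])
      then show "(\<lambda>l. max 0 (g x - real l)) \<longlonglongrightarrow> 0" by (rule tendsto_eventually)
    qed
  qed (use g gi in \<open>auto simp: max_def\<close>)
  then have "eventually (\<lambda>l. integral\<^sup>L M (\<lambda>x. max 0 (g x - real l)) <
      - integral\<^sup>L M (\<lambda>x. max (f x) (- real k))) sequentially"
    using fk(2) by (intro order_tendstoD(2)) auto
  then obtain l where l: "integral\<^sup>L M (\<lambda>x. max 0 (g x - real l)) <
      - integral\<^sup>L M (\<lambda>x. max (f x) (- real k))"
    using eventually_happens'[OF sequentially_bot] by blast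
  define r where "r x = max 0 (g x - real l)" for x
  have r: "integrable M r" unfolding r_def using gi by (intro integrable_max) auto
  have rT: "integrable M (\<lambda>x. r (T x))" "integral\<^sup>L M (\<lambda>x. r (T x)) = integral\<^sup>L M r"
    using integrable_T[OF r] integral_T[of r] r by auto
  \<comment> \<open>The cut-off \<open>f\<close> and the excess of \<open>g\<close> over
    \<open>l\<close> one step later; the choice of \<open>l\<close> keeps the total mean
    negative.\<close>
  define F where "F x = max (f x) (- real k) + r (T x)" for x
  have "integrable M F" unfolding F_def[abs_def] using fk(1) rT(1) by simp
  moreover have "integral\<^sup>L M F < 0"
    unfolding F_def[abs_def] using fk(1) rT l by (simp add: r_def[abs_def])
  ultimately have "AE x in M. \<exists>C c. 0 < c \<and> (\<forall>n. birkhoff_sum F n x \<le> C - c * real n)"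
    by (rule AE_birkhoff_sum_linear)
  then show ?thesis
  proof (rule AE_mp, intro AE_I2 impI)
    fix x assume x: "x \<in> space M" "\<exists>C c. 0 < c \<and> (\<forall>n. birkhoff_sum F n x \<le> C - c * real n)"
    then obtain C c where c: "0 < c" and C: "\<And>n. birkhoff_sum F n x \<le> C - c * real n" by blast
    have r_nonneg: "0 \<le> r y" for y by (simp add: r_def)
    \<comment> \<open>The term \<open>g x\<close> serves \<open>n = 0\<close>, where the sum of
      excesses is empty. For \<open>n = Suc m\<close> the summand \<open>j = m\<close> alone covers
      \<open>g ((T ^^ n) x)\<close>.\<close>
    have "birkhoff_sum f n x + g ((T ^^ n) x) \<le> (C + real l + g x) - c * real n" for n
    proof -
      have f_le: "birkhoff_sum f n x + (\<Sum>j<n. r (T ((T ^^ j) x))) \<le> birkhoff_sum F n x"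
        unfolding sum.distrib[symmetric] by (intro sum_mono) (auto simp: F_def)
      have "g ((T ^^ n) x) \<le> real l + g x + (\<Sum>j<n. r (T ((T ^^ j) x)))"
      proof (cases n)
        case 0
        then show ?thesis using g(1)[OF x(1)] by simp
      next
        case (Suc m)
        have "g ((T ^^ n) x) \<le> real l + r (T ((T ^^ m) x))" by (simp add: r_def Suc)
        also have "r (T ((T ^^ m) x)) \<le> (\<Sum>j<n. r (T ((T ^^ j) x)))"
          using Suc r_nonneg by (intro member_le_sum[of m "{..<n}" "\<lambda>j. r (T ((T ^^ j) x))"]) auto
        finally show ?thesis using g(1)[OF x(1)] by simp
      qed
      then show ?thesis using f_le C[of n] by linarith
    qed
    then show "\<exists>C c. 0 < c \<and> (\<forall>n. birkhoff_sum f n x + g ((T ^^ n) x) \<le> C - c * real n)"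
      using c by blast
  qed
qed

text \<open>If both parts have the same integral, it is finite and \<open>f\<close> is integrable
  with mean zero. Otherwise the linear bound for \<open>- f\<close>, with \<open>g = 0\<close>,
  keeps the sums of \<open>f\<close> bounded below.\<close>

lemma AE_birkhoff_sum_not_at_bot_ext:
  fixes f :: "'a \<Rightarrow> real"
  assumes [measurable]: "f \<in> borel_measurable M"
    and le: "(\<integral>\<^sup>+ x. ennreal (- f x) \<partial>M) \<le> (\<integral>\<^sup>+ x. ennreal (f x) \<partial>M)"
    and fin: "(\<integral>\<^sup>+ x. ennreal (- f x) \<partial>M) < \<infinity>"
  shows "AE x in M. \<not> filterlim (\<lambda>n. birkhoff_sum f n x) at_bot sequentially"
proof (cases "(\<integral>\<^sup>+ x. ennreal (- f x) \<partial>M) = (\<integral>\<^sup>+ x. ennreal (f x) \<partial>M)")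
  case True
  have int: "integrable M f"
    unfolding real_integrable_def using fin True by auto
  then have "integral\<^sup>L M f = 0" using True by (simp add: real_lebesgue_integral_def)
  with int show ?thesis by (rule AE_birkhoff_sum_not_at_bot)
next
  case False
  with le have "(\<integral>\<^sup>+ x. ennreal (- f x) \<partial>M) < (\<integral>\<^sup>+ x. ennreal (- (- f x)) \<partial>M)" by simp
  then have "AE x in M. \<exists>C c. 0 < c \<and>
      (\<forall>n. birkhoff_sum (\<lambda>x. - f x) n x + (\<lambda>x. 0) ((T ^^ n) x) \<le> C - c * real n)"
    by (intro AE_birkhoff_sum_plus_le_linear) auto
  then show ?thesis
  proof (rule AE_mp, intro AE_I2 impI notI)
    fix x assume "\<exists>C c. 0 < c \<and>
      (\<forall>n. birkhoff_sum (\<lambda>x. - f x) n x + (\<lambda>x. 0) ((T ^^ n) x) \<le> C - c * real n)"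
    then obtain C c where c: "0 < c" and C: "\<And>n. - birkhoff_sum f n x \<le> C - c * real n"
      by (auto simp: sum_negf)
    have lower: "- C \<le> birkhoff_sum f n x" for n
    proof -
      have "0 \<le> c * real n" using c by simp
      then show ?thesis using C[of n] by linarith
    qed
    assume "filterlim (\<lambda>n. birkhoff_sum f n x) at_bot sequentially"
    then have "eventually (\<lambda>n. birkhoff_sum f n x \<le> - C - 1) sequentially"
      unfolding filterlim_at_bot by blast
    then obtain n where "birkhoff_sum f n x \<le> - C - 1"
      using eventually_happens'[OF sequentially_bot] by blast
    with lower[of n] show False by simp
  qed
qed

end

section \<open>Nearest-neighbour walks in a fixed environment\<close>

lemma measurable_into_path_space:
  assumes "\<And>n. (\<lambda>x. f x n) \<in> measurable M (count_space UNIV)"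
  shows "f \<in> measurable M path_space"
  unfolding path_space_def by (rule measurable_PiM_single') (use assms in auto)

lemma measurable_path_component [measurable]: "(\<lambda>x. x n) \<in> measurable path_space (count_space UNIV)"
  unfolding path_space_def by measurable

lemma cylinder_sets [measurable]: "{x. \<forall>i\<le>n. x i = w i} \<in> sets path_space"
proof -
  have "{x \<in> space path_space. \<forall>i\<le>n. x i = w i} \<in> sets path_space" by measurable
  then show ?thesis by simp
qed

text \<open>Cylinders and the empty set form a generating pi-system. The cylinder of length 0 is the
  whole space and is not covered by \<open>eq\<close>; there the measures agree because both are
  probabilities.\<close>

lemma path_measure_eqI:
  assumes M: "sets M = sets path_space" and N: "sets N = sets path_space"
    and pM: "prob_space M" and pN: "prob_space N"
    and eq: "\<And>n w. emeasure M {x. \<forall>i\<le>n. x i = w i} = emeasure N {x. \<forall>i\<le>n. x i = w i}"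
  shows "M = N"
proof (rule measure_eqI_generator_eq)
  let ?c = "\<lambda>n w. {x. \<forall>i<n::nat. x i = (w i :: int)}"
  let ?G = "insert {} (range (\<lambda>(n, w). ?c n w))"
  show "Int_stable ?G"
  proof (rule Int_stableI)
    fix A B assume AB: "A \<in> ?G" "B \<in> ?G"
    show "A \<inter> B \<in> ?G"
    proof (cases "A \<inter> B = {}")
      case False
      then obtain x where x: "x \<in> A" "x \<in> B" by blast
      from AB x obtain n v m w where "A = ?c n v" "B = ?c m w" by auto
      with x have "A \<inter> B = ?c (max n m) x" by (auto simp: less_max_iff_disj)
      then show ?thesis by (auto intro!: image_eqI[of _ _ "(max n m, x)"])
    qed simp
  qed
  show "?G \<subseteq> Pow UNIV" by simp
  show "sets M = sigma_sets UNIV ?G" "sets N = sigma_sets UNIV ?G"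
    using M N by (simp_all add: sets_path_space_cylinders)
  have sp: "space M = UNIV" "space N = UNIV"
    using sets_eq_imp_space_eq[OF M] sets_eq_imp_space_eq[OF N] by simp_all
  show "emeasure M X = emeasure N X" if "X \<in> ?G" for X
  proof (cases "X = {}")
    case False
    with that obtain n w where X: "X = ?c n w" by auto
    show ?thesis
    proof (cases n)
      case 0
      then show ?thesis
        using prob_space.emeasure_space_1[OF pM] prob_space.emeasure_space_1[OF pN] sp X by simp
    next
      case (Suc m)
      then show ?thesis using eq[of m w] X by (simp add: less_Suc_eq_le)
    qed
  qed simp
  show "range (\<lambda>i::nat. UNIV) \<subseteq> ?G" by (auto intro!: image_eqI[of _ _ "(0, \<lambda>_. 0)"])
  show "emeasure M UNIV \<noteq> \<infinity>"
    using prob_space.emeasure_space_1[OF pM] sp by simp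
qed simp

lemma pmf_step:
  assumes "0 < \<omega> i" "\<omega> i < 1"
  shows "pmf (step_pmf \<omega> i) j = (if j = i + 1 then \<omega> i else if j = i - 1 then 1 - \<omega> i else 0)"
proof -
  have "pmf (step_pmf \<omega> i) j =
      measure (measure_pmf (bernoulli_pmf (\<omega> i))) ((\<lambda>b. if b then i + 1 else i - 1) -` {j})"
    by (simp add: step_pmf_def pmf_map)
  also have "(\<lambda>b. if b then i + 1 else i - 1) -` {j} =
      (if j = i + 1 then {True} else if j = i - 1 then {False} else {})"
    by (auto split: if_splits)
  finally show ?thesis using assms by (auto simp: measure_pmf_single)
qed

text \<open>\<open>quenched\<close> always starts at 0, so a start at \<open>i\<close> is encoded by
  recentring the environment at \<open>i\<close> and translating the path back.\<close>

definition walk_from :: "(int \<Rightarrow> real) \<Rightarrow> int \<Rightarrow> (nat \<Rightarrow> int) measure" where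
  "walk_from \<omega> i = distr (quenched (\<lambda>n. \<omega> (n + i))) path_space (\<lambda>x n. x n + i)"

lemma sets_walk_from [simp, measurable_cong]: "sets (walk_from \<omega> i) = sets path_space"
  by (simp add: walk_from_def)

lemma space_walk_from [simp]: "space (walk_from \<omega> i) = UNIV"
  by (simp add: walk_from_def)

lemma measurable_translate_path [measurable]: "(\<lambda>x n. x n + i) \<in> measurable path_space path_space"
  by (rule measurable_into_path_space) measurable

lemma walk_from_0: "walk_from \<omega> 0 = quenched \<omega>"
proof -
  have "distr (quenched \<omega>) path_space (\<lambda>x. x) = quenched \<omega>"
    by (rule distr_id2) simp
  then show ?thesis by (simp add: walk_from_def)
qed

lemma measurable_negate_path [measurable]: "(\<lambda>x n. - x n) \<in> measurable path_space path_space"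
  by (rule measurable_into_path_space) (rule measurable_compose[OF measurable_path_component], simp)

lemma measurable_shift_path [measurable]: "(\<lambda>x n. x (Suc n)) \<in> measurable path_space path_space"
  by (rule measurable_into_path_space) measurable

locale nn_walk =
  fixes \<omega> :: "int \<Rightarrow> real"
  assumes omega_bounds: "0 < \<omega> i" "\<omega> i < 1"
begin

text \<open>From here on \<open>prob i\<close> refers to the walk started at
  \<open>i\<close>.\<close>

sublocale prob_space "walk_from \<omega> i" for i
  unfolding walk_from_def
  by (rule prob_space.prob_space_distr[OF prob_space_quenched])
     (simp add: measurable_cong_sets[OF sets_quenched refl])

lemma emeasure_cylinder:
  "emeasure (walk_from \<omega> i) {x. \<forall>k\<le>n. x k = w k} =
     (if w 0 = i then ennreal (\<Prod>k<n. pmf (step_pmf \<omega> (w k)) (w (Suc k))) else 0)"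
proof -
  let ?\<omega> = "\<lambda>n. \<omega> (n + i)"
  have "emeasure (walk_from \<omega> i) {x. \<forall>k\<le>n. x k = w k} =
      emeasure (quenched ?\<omega>) ((\<lambda>x n. x n + i) -` {x. \<forall>k\<le>n. x k = w k} \<inter> space (quenched ?\<omega>))"
    unfolding walk_from_def
    by (rule emeasure_distr) (simp_all add: measurable_cong_sets[OF sets_quenched refl] cylinder_sets)
  also have "(\<lambda>x n. x n + i) -` {x. \<forall>k\<le>n. x k = w k} \<inter> space (quenched ?\<omega>) = {x. \<forall>k\<le>n. x k = w k - i}"
    by (auto simp: eq_diff_eq)
  also have "emeasure (quenched ?\<omega>) \<dots> =
      (if w 0 = i then ennreal (\<Prod>k<n. pmf (step_pmf ?\<omega> (w k - i)) (w (Suc k) - i)) else 0)"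
    using emeasure_quenched_cylinder[of ?\<omega> n "\<lambda>k. w k - i"] by simp
  finally have *: "emeasure (walk_from \<omega> i) {x. \<forall>k\<le>n. x k = w k} = \<dots>" .
  have "pmf (step_pmf ?\<omega> (w k - i)) (w (Suc k) - i) = pmf (step_pmf \<omega> (w k)) (w (Suc k))" for k
    using omega_bounds[of "w k"] by (subst (1 2) pmf_step) auto
  with * show ?thesis by simp
qed

lemma AE_start: "AE x in walk_from \<omega> i. x 0 = i"
proof -
  have "emeasure (walk_from \<omega> i) {x. \<forall>k\<le>0. x k = i} = 1"
    using emeasure_cylinder[of i 0 "\<lambda>_. i"] by simp
  then have "prob i {x. x 0 = i} = 1" by (simp add: emeasure_eq_measure)
  moreover have "{x. x 0 = i} \<in> events i" using cylinder_sets[of 0 "\<lambda>_. i"] by simp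
  ultimately show ?thesis by (auto simp: prob_eq_1)
qed

text \<open>The Markov property at time 1, verified on cylinders.\<close>

lemma walk_shift:
  "distr (walk_from \<omega> i) path_space (\<lambda>x n. x (Suc n)) = measure_pmf (step_pmf \<omega> i) \<bind> walk_from \<omega>"
proof -
  have K: "walk_from \<omega> \<in> measurable (measure_pmf (step_pmf \<omega> i)) (subprob_algebra path_space)"
    by (auto simp: space_subprob_algebra intro: prob_space_imp_subprob_space prob_space_axioms)
  show ?thesis
  proof (rule path_measure_eqI)
    show "sets (measure_pmf (step_pmf \<omega> i) \<bind> walk_from \<omega>) = sets path_space"
      by (rule sets_bind) auto
    show "prob_space (measure_pmf (step_pmf \<omega> i) \<bind> walk_from \<omega>)"
      by (rule measure_pmf.prob_space_bind[OF _ K]) (simp add: prob_space_axioms)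
    show "prob_space (distr (walk_from \<omega> i) path_space (\<lambda>x n. x (Suc n)))"
      by (rule prob_space_distr) measurable
    fix n and w :: "nat \<Rightarrow> int"
    let ?A = "{x. \<forall>k\<le>n. x k = w k}"
    let ?p = "ennreal (\<Prod>k<n. pmf (step_pmf \<omega> (w k)) (w (Suc k)))"
    \<comment> \<open>Prepending the start \<open>i\<close> to \<open>w\<close> turns a cylinder for
      the shifted path into one that is a step longer, up to a null set.\<close>
    define v where "v k = (case k of 0 \<Rightarrow> i | Suc m \<Rightarrow> w m)" for k
    have "emeasure (distr (walk_from \<omega> i) path_space (\<lambda>x n. x (Suc n))) ?A =
        emeasure (walk_from \<omega> i) ((\<lambda>x n. x (Suc n)) -` ?A \<inter> space (walk_from \<omega> i))"
      by (rule emeasure_distr[OF _ cylinder_sets])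
         (simp add: measurable_cong_sets[OF sets_walk_from refl] measurable_shift_path)
    also have "\<dots> = emeasure (walk_from \<omega> i) {x. \<forall>k\<le>Suc n. x k = v k}"
    proof (rule emeasure_eq_AE)
      show "AE x in walk_from \<omega> i. (x \<in> (\<lambda>x n. x (Suc n)) -` ?A \<inter> space (walk_from \<omega> i)) =
          (x \<in> {x. \<forall>k\<le>Suc n. x k = v k})"
        using AE_start[of i]
      proof eventually_elim
        case (elim x)
        have "(\<forall>k\<in>{..Suc n}. x k = v k) \<longleftrightarrow> x 0 = v 0 \<and> (\<forall>k\<in>{..n}. x (Suc k) = v (Suc k))"
          unfolding atMost_Suc_eq_insert_0 by simp
        then show ?case using elim unfolding v_def Ball_def atMost_iff by simp
      qed
      have "(\<lambda>x n. x (Suc n)) -` ?A \<inter> space path_space \<in> sets path_space"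
        by (rule measurable_sets[OF measurable_shift_path cylinder_sets])
      then show "(\<lambda>x n. x (Suc n)) -` ?A \<inter> space (walk_from \<omega> i) \<in> events i" by simp
    qed (simp add: cylinder_sets)
    also have "\<dots> = ennreal (pmf (step_pmf \<omega> i) (w 0)) * ?p"
      unfolding emeasure_cylinder
      by (simp add: v_def prod.lessThan_Suc_shift ennreal_mult' prod_nonneg del: prod.lessThan_Suc)
    also have "\<dots> = (\<integral>\<^sup>+ j. ?p * indicator {w 0} j \<partial>measure_pmf (step_pmf \<omega> i))"
      by (subst nn_integral_cmult_indicator) (auto simp: emeasure_pmf_single mult.commute)
    also have "\<dots> = (\<integral>\<^sup>+ j. emeasure (walk_from \<omega> j) ?A \<partial>measure_pmf (step_pmf \<omega> i))"
      by (intro nn_integral_cong) (auto simp: emeasure_cylinder indicator_def)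
    also have "\<dots> = emeasure (measure_pmf (step_pmf \<omega> i) \<bind> walk_from \<omega>) ?A"
      by (rule emeasure_bind[OF _ K cylinder_sets, symmetric]) simp
    finally show "emeasure (distr (walk_from \<omega> i) path_space (\<lambda>x n. x (Suc n))) ?A =
        emeasure (measure_pmf (step_pmf \<omega> i) \<bind> walk_from \<omega>) ?A" .
  qed simp
qed

text \<open>First-step analysis. For an event unaffected by dropping the initial position it says
  that the probability is harmonic in the starting point.\<close>

lemma prob_first_step:
  assumes A: "A \<in> sets path_space"
  shows "prob i {x. (\<lambda>n. x (Suc n)) \<in> A} = \<omega> i * prob (i + 1) A + (1 - \<omega> i) * prob (i - 1) A"
proof -
  have K: "walk_from \<omega> \<in> measurable (measure_pmf (step_pmf \<omega> i)) (subprob_algebra path_space)"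
    by (auto simp: space_subprob_algebra intro: prob_space_imp_subprob_space prob_space_axioms)
  have "ennreal (prob i {x. (\<lambda>n. x (Suc n)) \<in> A}) =
      emeasure (distr (walk_from \<omega> i) path_space (\<lambda>x n. x (Suc n))) A"
    using A by (subst emeasure_distr) (auto simp: emeasure_eq_measure vimage_def)
  also have "\<dots> = (\<integral>\<^sup>+ j. emeasure (walk_from \<omega> j) A \<partial>measure_pmf (step_pmf \<omega> i))"
    unfolding walk_shift by (rule emeasure_bind[OF _ K A]) simp
  also have "\<dots> = (\<integral>\<^sup>+ b. emeasure (walk_from \<omega> (if b then i + 1 else i - 1)) A
      \<partial>measure_pmf (bernoulli_pmf (\<omega> i)))"
    by (simp add: step_pmf_def)
  also have "\<dots> = ennreal (\<omega> i) * prob (i + 1) A + ennreal (1 - \<omega> i) * prob (i - 1) A"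
    using omega_bounds[of i] by (simp add: emeasure_eq_measure mult.commute)
  also have "\<dots> = ennreal (\<omega> i * prob (i + 1) A + (1 - \<omega> i) * prob (i - 1) A)"
    using omega_bounds[of i] by (simp add: ennreal_mult' ennreal_plus less_imp_le)
  finally show ?thesis
    using omega_bounds[of i] by (subst (asm) ennreal_inj) (auto intro!: add_nonneg_nonneg mult_nonneg_nonneg simp: less_imp_le)
qed

end

section \<open>Recurrence and transience from a harmonic function\<close>

locale harmonic_walk = nn_walk +
  fixes h :: "int \<Rightarrow> real"
  assumes h_step: "h i < h (i + 1)"
    and h_harmonic: "\<omega> i * (h (i + 1) - h i) = (1 - \<omega> i) * (h i - h (i - 1))"
begin

lemma h_strict_mono: "strict_mono h"
proof (rule strict_monoI)
  fix i j :: int assume "i < j"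
  then show "h i < h j"
    by (induction j rule: int_gr_induct) (use h_step less_trans in blast)+
qed

text \<open>Solving the recursion shows that \<open>u\<close> is affine in \<open>h\<close> on \<open>{..N}\<close>.\<close>

lemma bounded_harmonic_constant:
  assumes harm: "\<And>i. i < N \<Longrightarrow> u i = \<omega> i * u (i + 1) + (1 - \<omega> i) * u (i - 1)"
    and bound: "\<And>i. 0 \<le> u i" "\<And>i. u i \<le> (1::real)"
    and unbounded: "\<And>C. \<exists>i. h i < C"
    and "i \<le> N"
  shows "u i = u N"
proof -
  \<comment> \<open>The slope of \<open>u\<close> against \<open>h\<close> on the rightmost
    increment. Harmonicity at \<open>j - 1\<close> carries it from the increment ending at
    \<open>j\<close> to the one ending at \<open>j - 1\<close>.\<close>
  define c where "c = (u N - u (N - 1)) / (h N - h (N - 1))"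
  have h_pos: "0 < h j - h (j - 1)" for j using h_step[of "j - 1"] by simp
  have increment: "u j - u (j - 1) = c * (h j - h (j - 1))" if "j \<le> N" for j
    using that
  proof (induction j rule: int_le_induct)
    case base
    show ?case using h_pos[of N] by (simp add: c_def)
  next
    case (step j)
    have "\<omega> (j - 1) * (u j - u (j - 1)) = (1 - \<omega> (j - 1)) * (u (j - 1) - u (j - 1 - 1))"
      using harm[of "j - 1"] step.hyps by (simp add: algebra_simps)
    moreover have "\<omega> (j - 1) * (u j - u (j - 1)) = c * ((1 - \<omega> (j - 1)) * (h (j - 1) - h (j - 1 - 1)))"
      unfolding h_harmonic[of "j - 1", symmetric] using step.IH by simp
    ultimately have "(1 - \<omega> (j - 1)) * (u (j - 1) - u (j - 1 - 1)) =
        (1 - \<omega> (j - 1)) * (c * (h (j - 1) - h (j - 1 - 1)))"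
      by (simp add: algebra_simps)
    then show ?case using omega_bounds(2)[of "j - 1"] by simp
  qed
  have affine: "u N - u j = c * (h N - h j)" if "j \<le> N" for j
    using that
  proof (induction j rule: int_le_induct)
    case (step j)
    then show ?case using increment[of j]
      by (simp add: algebra_simps)
  qed simp
  have "c = 0"
  proof (rule ccontr)
    assume c: "c \<noteq> 0"
    \<comment> \<open>So far to the left, a nonzero slope would make \<open>u\<close> vary by more
      than 1, against its bounds.\<close>
    obtain j where j: "h j < h N - 1 / \<bar>c\<bar>" using unbounded by blast
    moreover have "h N - 1 / \<bar>c\<bar> \<le> h N" by simp
    ultimately have "j < N" using strict_mono_less[OF h_strict_mono, of j N] by linarith
    have "1 < \<bar>c\<bar> * (h N - h j)"
      using j c by (simp add: field_simps)
    also have "\<dots> = \<bar>u N - u j\<bar>"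
      using affine[of j] \<open>j < N\<close> strict_mono_less[OF h_strict_mono, of j N] by (simp add: abs_mult)
    also have "\<dots> \<le> 1" using bound[of N] bound[of j] by (simp add: abs_if)
    finally show False by simp
  qed
  then show ?thesis using affine[OF \<open>i \<le> N\<close>] by simp
qed

text \<open>The probability of staying below \<open>N\<close> is harmonic in the start to the left
  of \<open>N\<close>, hence constant there, and it vanishes for the start \<open>N\<close>.\<close>

lemma never_reach_null:
  assumes unbounded: "\<And>C. \<exists>i. h i < C" and "i \<le> N"
  shows "prob i {x. \<forall>n. x n < N} = 0"
proof -
  let ?A = "{x. \<forall>n::nat. x n < N}"
  have A: "?A \<in> sets path_space"
  proof -
    have "{x \<in> space path_space. \<forall>n. x n < N} \<in> sets path_space" by measurable
    then show ?thesis by simp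
  qed
  have "prob i ?A = prob N ?A"
  proof (rule bounded_harmonic_constant[OF _ _ _ unbounded \<open>i \<le> N\<close>])
    fix j assume "j < N"
    \<comment> \<open>A start \<open>j < N\<close> meets the condition at time 0, so ignoring time 0
      changes the event by a null set only.\<close>
    have "prob j ?A = prob j {x. (\<lambda>n. x (Suc n)) \<in> ?A}"
    proof (rule measure_eq_AE)
      show "AE x in walk_from \<omega> j. (x \<in> ?A) = (x \<in> {x. (\<lambda>n. x (Suc n)) \<in> ?A})"
        using AE_start[of j] by eventually_elim (use \<open>j < N\<close> in \<open>auto, metis not0_implies_Suc\<close>)
    qed (use A measurable_sets[OF measurable_shift_path A] in \<open>auto simp: vimage_def\<close>)
    then show "prob j ?A = \<omega> j * prob (j + 1) ?A + (1 - \<omega> j) * prob (j - 1) ?A"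
      using prob_first_step[OF A] by simp
  qed auto
  also have "prob N ?A = 0"
  proof -
    have "AE x in walk_from \<omega> N. x \<notin> ?A"
      using AE_start[of N] by eventually_elim (auto intro: exI[of _ 0])
    then show ?thesis using A by (subst prob_eq_0) auto
  qed
  finally show ?thesis .
qed

lemma AE_sup_infinite:
  assumes unbounded: "\<And>C. \<exists>i. h i < C"
  shows "AE x in quenched \<omega>. \<forall>N. \<exists>n. N \<le> x n"
proof -
  have "AE x in walk_from \<omega> 0. \<exists>n. N \<le> x n" for N
  proof -
    \<comment> \<open>\<open>never_reach_null\<close> needs a level at or to the right of the start
      0.\<close>
    let ?A = "{x. \<forall>n::nat. x n < max 0 N}"
    have "{x \<in> space path_space. \<forall>n. x n < max 0 N} \<in> sets path_space" by measurable
    then have "?A \<in> events 0" by simp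
    then have "AE x in walk_from \<omega> 0. x \<notin> ?A"
      using never_reach_null[OF unbounded, of 0 "max 0 N"] prob_eq_0 by auto
    then show ?thesis by eventually_elim (auto simp: not_less)
  qed
  then show ?thesis unfolding walk_from_0 by (simp add: AE_all_countable)
qed

text \<open>The right-hand side is harmonic, nonnegative, and at least 1 on \<open>{..j}\<close>, so it dominates the
  probability of reaching \<open>{..j}\<close> within \<open>n\<close> steps for every \<open>n\<close>.\<close>

lemma reach_le:
  assumes upper: "\<And>i. h i \<le> R" and "h j < R"
  shows "prob i {x. \<exists>n. x n \<le> j} \<le> (R - h i) / (R - h j)"
proof -
  let ?B = "\<lambda>n. {x. \<exists>k\<le>n::nat. x k \<le> j}"
  let ?w = "\<lambda>i. (R - h i) / (R - h j)"
  have B: "?B n \<in> sets path_space" for n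
  proof -
    have "{x \<in> space path_space. \<exists>k\<le>n. x k \<le> j} \<in> sets path_space" by measurable
    then show ?thesis by simp
  qed
  have w_ge: "1 \<le> ?w i" if "i \<le> j" for i
    using strict_mono_less_eq[OF h_strict_mono, of i j] that \<open>h j < R\<close> by (simp add: field_simps)
  have w_harm: "\<omega> i * ?w (i + 1) + (1 - \<omega> i) * ?w (i - 1) = ?w i" for i
  proof -
    have "\<omega> i * (R - h (i + 1)) + (1 - \<omega> i) * (R - h (i - 1)) = R - h i"
      using h_harmonic[of i] by (simp add: algebra_simps)
    then show ?thesis by (simp add: add_divide_distrib[symmetric])
  qed
  have le: "prob i (?B n) \<le> ?w i" for n i
  proof (induction n arbitrary: i)
    case 0
    show ?case
    proof (cases "i \<le> j")
      case True
      then show ?thesis using w_ge[OF True] prob_le_1[of i "?B 0"] by linarith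
    next
      case False
      have "AE x in walk_from \<omega> i. x \<notin> ?B 0"
        using AE_start[of i] by eventually_elim (use False in auto)
      then have "prob i (?B 0) = 0" using B[of 0] by (simp add: prob_eq_0)
      then show ?thesis using upper[of i] \<open>h j < R\<close> by simp
    qed
  next
    case (Suc n)
    show ?case
    proof (cases "i \<le> j")
      case True
      then show ?thesis using w_ge[OF True] prob_le_1[of i "?B (Suc n)"] by linarith
    next
      case False
      have "prob i (?B (Suc n)) = prob i {x. (\<lambda>n. x (Suc n)) \<in> ?B n}"
      proof (rule measure_eq_AE)
        show "AE x in walk_from \<omega> i. (x \<in> ?B (Suc n)) = (x \<in> {x. (\<lambda>n. x (Suc n)) \<in> ?B n})"
          using AE_start[of i]
        proof eventually_elim
          case (elim x)
          have "(\<exists>k\<le>Suc n. x k \<le> j) \<longleftrightarrow> x 0 \<le> j \<or> (\<exists>k\<le>n. x (Suc k) \<le> j)"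
            by (metis Suc_le_mono le0 not0_implies_Suc)
          then show ?case using elim False by auto
        qed
      qed (use B measurable_sets[OF measurable_shift_path B] in \<open>auto simp: vimage_def\<close>)
      also have "\<dots> \<le> \<omega> i * ?w (i + 1) + (1 - \<omega> i) * ?w (i - 1)"
        unfolding prob_first_step[OF B]
        using omega_bounds[of i] by (intro add_mono mult_left_mono Suc) auto
      finally show ?thesis unfolding w_harm .
    qed
  qed
  have "(\<lambda>n. prob i (?B n)) \<longlonglongrightarrow> prob i (\<Union>n. ?B n)"
    by (rule finite_Lim_measure_incseq) (use B in \<open>auto simp: incseq_def intro: order_trans\<close>)
  then have "prob i (\<Union>n. ?B n) \<le> ?w i"
    by (rule LIMSEQ_le_const2) (use le in blast)
  also have "(\<Union>n. ?B n) = {x. \<exists>n. x n \<le> j}" by auto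
  finally show ?thesis .
qed

lemma AE_at_top:
  assumes unbounded: "\<And>C. \<exists>i. h i < C" and bounded: "\<And>i. h i \<le> C"
  shows "AE x in quenched \<omega>. filterlim x at_top sequentially"
proof -
  \<comment> \<open>The probability of visiting \<open>{..j}\<close> infinitely often is harmonic, hence constant in the starting
    point, while \<open>reach_le\<close> makes it small for starting points far to the right.\<close>
  define R where "R = (SUP i. h i)"
  have bdd: "bdd_above (range h)" using bounded by (auto simp: bdd_above_def)
  have upper: "h i \<le> R" for i unfolding R_def by (rule cSUP_upper[OF _ bdd]) simp
  \<comment> \<open>A strictly increasing \<open>h\<close> does not attain its supremum, so the
    denominator in \<open>reach_le\<close> is positive.\<close>
  have upper': "h i < R" for i using h_step[of i] upper[of "i + 1"] by linarith
  have "AE x in walk_from \<omega> 0. \<exists>m. \<forall>n\<ge>m. j < x n" for j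
  proof -
    let ?A = "{x. \<forall>m::nat. \<exists>n\<ge>m. x n \<le> j}"
    have A: "?A \<in> sets path_space"
    proof -
      have "{x \<in> space path_space. \<forall>m. \<exists>n\<ge>m. x n \<le> j} \<in> sets path_space" by measurable
      then show ?thesis by simp
    qed
    have "{x \<in> space path_space. \<exists>n. x n \<le> j} \<in> sets path_space" by measurable
    then have E: "{x. \<exists>n. x n \<le> j} \<in> sets path_space" by simp
    have sh: "{x. (\<lambda>n. x (Suc n)) \<in> ?A} = ?A"
    proof -
      have "(\<forall>m. \<exists>n\<ge>m. x (Suc n) \<le> j) \<longleftrightarrow> (\<forall>m. \<exists>n\<ge>m. x n \<le> j)" for x :: "nat \<Rightarrow> int"
        by (metis Suc_le_D Suc_le_mono le_SucI)
      then show ?thesis by simp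
    qed
    have const: "prob i ?A = prob k ?A" if "i \<le> k" for i k
    proof (rule bounded_harmonic_constant[OF _ _ _ unbounded that])
      show "prob l ?A = \<omega> l * prob (l + 1) ?A + (1 - \<omega> l) * prob (l - 1) ?A" for l
        using prob_first_step[OF A, of l] unfolding sh .
    qed simp_all
    have "prob 0 ?A \<le> e" if "0 < e" for e
    proof -
      \<comment> \<open>This selects a start \<open>i\<close> at which the bound of
        \<open>reach_le\<close> is below \<open>e\<close>.\<close>
      have "R - e * (R - h j) < (SUP i. h i)" using that upper'[of j] by (simp add: R_def[symmetric])
      then obtain i where i: "R - e * (R - h j) < h i"
        unfolding less_cSUP_iff[OF UNIV_not_empty bdd] by blast
      have "prob 0 ?A = prob i ?A" 
        using const[of 0 i] const[of i 0] linear[of 0 i] by argo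
      also have "\<dots> \<le> prob i {x. \<exists>n. x n \<le> j}"
        using E by (intro finite_measure_mono) auto
      also have "\<dots> \<le> (R - h i) / (R - h j)" by (rule reach_le[OF upper upper'])
      also have "\<dots> \<le> e" using i upper'[of j] by (simp add: field_simps)
      finally show ?thesis .
    qed
    then have "prob 0 ?A \<le> 0" by (rule dense_ge)
    then have "prob 0 ?A = 0" by (simp add: order_antisym)
    then have "AE x in walk_from \<omega> 0. x \<notin> ?A" using A prob_eq_0 by auto
    then show ?thesis by eventually_elim (use not_le in blast)
  qed
  then have "AE x in quenched \<omega>. \<forall>j. \<exists>m. \<forall>n\<ge>m. j < x n"
    unfolding walk_from_0 by (simp add: AE_all_countable)
  then show ?thesis
    by eventually_elim (auto simp: filterlim_at_top eventually_sequentially intro: less_imp_le; meson less_imp_le)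
qed

end

section \<open>Reflection of the line\<close>

lemma quenched_reflect:
  assumes "nn_walk \<omega>"
  shows "quenched (\<lambda>n. 1 - \<omega> (- n)) = distr (quenched \<omega>) path_space (\<lambda>x n. - x n)"
proof -
  interpret nn_walk \<omega> by fact
  show ?thesis
  proof (rule path_measure_eqI)
    show "prob_space (distr (quenched \<omega>) path_space (\<lambda>x n. - x n))"
      by (rule prob_space.prob_space_distr[OF prob_space_quenched]) measurable
    fix n and w :: "nat \<Rightarrow> int"
    \<comment> \<open>A step to the right from \<open>a\<close> in the reflected environment is a
      step to the left from \<open>- a\<close> in the original one, so cylinder weights
      match.\<close>
    have p: "pmf (step_pmf (\<lambda>n. 1 - \<omega> (- n)) a) b = pmf (step_pmf \<omega> (- a)) (- b)" for a b
      using omega_bounds[of "- a"] by (subst (1 2) pmf_step) auto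
    have "emeasure (distr (quenched \<omega>) path_space (\<lambda>x n. - x n)) {x. \<forall>i\<le>n. x i = w i} =
        emeasure (quenched \<omega>) ((\<lambda>x n. - x n) -` {x. \<forall>i\<le>n. x i = w i} \<inter> space (quenched \<omega>))"
      by (rule emeasure_distr[OF _ cylinder_sets]) measurable
    also have "(\<lambda>x n. - x n) -` {x. \<forall>i\<le>n. x i = w i} \<inter> space (quenched \<omega>) = {x. \<forall>i\<le>n. x i = - w i}"
    proof -
      have "- a = b \<longleftrightarrow> a = - b" for a b :: int by auto
      then show ?thesis by simp
    qed
    finally show "emeasure (quenched (\<lambda>n. 1 - \<omega> (- n))) {x. \<forall>i\<le>n. x i = w i} =
        emeasure (distr (quenched \<omega>) path_space (\<lambda>x n. - x n)) {x. \<forall>i\<le>n. x i = w i}"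
      by (simp add: emeasure_quenched_cylinder p)
  qed (auto simp: prob_space_quenched)
qed

context harmonic_walk
begin

text \<open>Both sign changes together keep the function increasing, while bounds from above and
  from below change places.\<close>

lemma reflected: "harmonic_walk (\<lambda>n. 1 - \<omega> (- n)) (\<lambda>n. - h (- n))"
proof
  fix i
  show "0 < 1 - \<omega> (- i)" "1 - \<omega> (- i) < 1" using omega_bounds[of "- i"] by simp_all
  show "- h (- i) < - h (- (i + 1))" using h_step[of "- i - 1"] by simp
  have "- (i + 1) = - i - 1" "- (i - 1) = - i + 1" by simp_all
  then show "(1 - \<omega> (- i)) * (- h (- (i + 1)) - - h (- i)) = (1 - (1 - \<omega> (- i))) * (- h (- i) - - h (- (i - 1)))"
    using h_harmonic[of "- i"] by simp
qed

lemma AE_reflected: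
  assumes "AE x in quenched (\<lambda>n. 1 - \<omega> (- n)). Q x"
  shows "AE x in quenched \<omega>. Q (\<lambda>n. - x n)"
proof -
  show ?thesis
    using assms unfolding quenched_reflect[OF nn_walk_axioms] by (rule AE_distrD[rotated]) measurable
qed

lemma AE_inf_infinite:
  assumes unbounded: "\<And>C. \<exists>i. C < h i"
  shows "AE x in quenched \<omega>. \<forall>N. \<exists>n. x n \<le> N"
proof -
  interpret r: harmonic_walk "\<lambda>n. 1 - \<omega> (- n)" "\<lambda>n. - h (- n)" by (rule reflected)
  have "\<exists>i. - h (- i) < C" for C
    using unbounded[of "- C"] by (metis minus_less_iff minus_minus)
  then have "AE x in quenched \<omega>. \<forall>N. \<exists>n. N \<le> - x n"
    by (intro AE_reflected r.AE_sup_infinite)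
  then show ?thesis by eventually_elim (metis minus_minus le_minus_iff)
qed

lemma AE_at_bot:
  assumes unbounded: "\<And>C. \<exists>i. C < h i" and bounded: "\<And>i. C \<le> h i"
  shows "AE x in quenched \<omega>. filterlim x at_bot sequentially"
proof -
  interpret r: harmonic_walk "\<lambda>n. 1 - \<omega> (- n)" "\<lambda>n. - h (- n)" by (rule reflected)
  have unbounded': "\<exists>i. - h (- i) < D" for D
    using unbounded[of "- D"] by (metis minus_less_iff minus_minus)
  have bounded': "- h (- i) \<le> - C" for i using bounded[of "- i"] by simp
  have "AE x in quenched \<omega>. filterlim (\<lambda>n. - x n) at_top sequentially"
    by (rule AE_reflected) (rule r.AE_at_top[OF unbounded' bounded'])
  then show ?thesis
  proof eventually_elim
    case (elim x)
    show ?case unfolding filterlim_at_bot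
    proof
      fix Z show "eventually (\<lambda>n. x n \<le> Z) sequentially"
        using elim[unfolded filterlim_at_top, rule_format, of "- Z"] by eventually_elim simp
    qed
  qed
qed

end

section \<open>The harmonic function of a sparse environment\<close>

text \<open>The two-sided antidifference of \<open>g\<close> that vanishes at 0, in the convention
  of \<open>site\<close>: \<open>g n\<close> is the increment from \<open>n - 1\<close> to
  \<open>n\<close>.\<close>

definition cumulative :: "(int \<Rightarrow> 'a::ab_group_add) \<Rightarrow> int \<Rightarrow> 'a" where
  "cumulative g n = (if 0 \<le> n then (\<Sum>k\<in>{1..n}. g k) else - (\<Sum>k\<in>{n+1..0}. g k))"

lemma cumulative_0 [simp]: "cumulative g 0 = 0"
  by (simp add: cumulative_def)

lemma cumulative_step: "cumulative g n = cumulative g (n - 1) + g n"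
proof -
  consider "n \<ge> 1" | "n = 0" | "n < 0" by linarith
  then show ?thesis
  proof cases
    case 1
    then have "{1..n} = insert n {1..n-1}" by auto
    with 1 show ?thesis by (simp add: cumulative_def)
  next
    case 2
    then show ?thesis by (simp add: cumulative_def)
  next
    case 3
    then have "{n..0} = insert n {n+1..0}" by auto
    with 3 show ?thesis by (simp add: cumulative_def)
  qed
qed

lemma cumulative_Suc: "cumulative g (n + 1) = cumulative g n + g (n + 1)"
  using cumulative_step[of g "n + 1"] by simp

lemma cumulative_of_nat: "cumulative g (int n) = (\<Sum>j<n. g (int j + 1))"
proof (induction n)
  case (Suc n)
  then show ?case using cumulative_Suc[of g "int n"] by (simp add: add.commute)
qed simp

lemma cumulative_of_neg_nat: "cumulative g (- int n) = (\<Sum>j<n. - g (- int j))"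
proof (induction n)
  case (Suc n)
  have "cumulative g (- int (Suc n)) = cumulative g (- int n - 1)" by (rule arg_cong[of _ _ "cumulative g"]) simp
  also have "\<dots> = (\<Sum>j<Suc n. - g (- int j))" using Suc cumulative_step[of g "- int n"] by (simp add: eq_diff_eq)
  finally show ?case .
qed simp

definition odds :: "(int \<Rightarrow> real \<times> nat) \<Rightarrow> int \<Rightarrow> real" where
  "odds e n = (1 - sparse_env e n) / sparse_env e n"

definition potential :: "(int \<Rightarrow> real \<times> nat) \<Rightarrow> int \<Rightarrow> real" where
  "potential e = cumulative (\<lambda>k. ln (xi e k))"

text \<open>The potential indexed by points of the line, whereas \<open>potential\<close> is indexed
  by marks.\<close>

definition site_potential :: "(int \<Rightarrow> real \<times> nat) \<Rightarrow> int \<Rightarrow> real" where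
  "site_potential e = cumulative (\<lambda>n. ln (odds e n))"

text \<open>The classical scale function. With the index \<open>n - 1\<close> the two increments
  meeting at \<open>n\<close> have ratio \<open>odds e n\<close>.\<close>

definition scale :: "(int \<Rightarrow> real \<times> nat) \<Rightarrow> int \<Rightarrow> real" where
  "scale e = cumulative (\<lambda>n. exp (site_potential e (n - 1)))"

lemma scale_Suc: "scale e (n + 1) = scale e n + exp (site_potential e n)"
  unfolding scale_def by (simp add: cumulative_Suc)

lemma sparse_env_bounds:
  assumes "e \<in> space seq_space"
  shows "0 < sparse_env e n" "sparse_env e n < 1"
proof -
  have "0 < sparse_env e n \<and> sparse_env e n < 1"
  proof (cases "\<exists>k. site e k = n")
    case True
    then show ?thesis using sparse_env_site[OF assms] lam_bounds[OF assms] by metis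
  next
    case False
    then show ?thesis by (simp add: sparse_env_def)
  qed
  then show "0 < sparse_env e n" "sparse_env e n < 1" by simp_all
qed

lemma odds_pos: "e \<in> space seq_space \<Longrightarrow> 0 < odds e n"
  unfolding odds_def using sparse_env_bounds[of e n] by simp

lemma odds_site: "e \<in> space seq_space \<Longrightarrow> odds e (site e k) = xi e k"
  by (simp add: odds_def xi_def sparse_env_site)

lemma site_Suc: "site e (k + 1) = site e k + int (gap e (k + 1))"
  using site_step[of e "k + 1"] by simp

lemma odds_between_sites:
  assumes "e \<in> space seq_space" "site e k < n" "n < site e (k + 1)"
  shows "odds e n = 1"
proof -
  have "site e j \<noteq> n" for j
    using assms(2,3) strict_mono_less[OF site_strict_mono[OF assms(1)], of k j]
      strict_mono_less[OF site_strict_mono[OF assms(1)], of j "k + 1"] by auto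
  then show ?thesis by (simp add: odds_def sparse_env_def)
qed

text \<open>Strictly between marked sites \<open>odds\<close> is 1, which adds
  \<open>ln 1 = 0\<close>; the strict bound on \<open>m\<close> stops short of the next
  mark.\<close>

lemma site_potential_block:
  assumes e: "e \<in> space seq_space"
  shows "m < gap e (k + 1) \<Longrightarrow> site_potential e (site e k + int m) = site_potential e (site e k)"
proof (induction m)
  case (Suc m)
  have "odds e (site e k + int m + 1) = 1"
    using Suc.prems by (intro odds_between_sites[OF e, of k]) (simp_all add: site_Suc)
  moreover have "site_potential e (site e k + int m + 1) =
      site_potential e (site e k + int m) + ln (odds e (site e k + int m + 1))"
    unfolding site_potential_def by (rule cumulative_Suc)
  ultimately show ?case using Suc by (simp add: add_ac)
qed simp

lemma site_potential_site_Suc: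
  assumes e: "e \<in> space seq_space"
  shows "site_potential e (site e (k + 1)) = site_potential e (site e k) + ln (xi e (k + 1))"
proof -
  have g: "1 \<le> gap e (k + 1)" by (rule gap_pos[OF e])
  have "site e (k + 1) - 1 = site e k + int (gap e (k + 1) - 1)"
    using g by (simp add: site_Suc)
  then have "site_potential e (site e (k + 1) - 1) = site_potential e (site e k)"
    using site_potential_block[OF e, of "gap e (k + 1) - 1" k] g by (simp del: of_nat_diff)
  moreover have "site_potential e (site e (k + 1)) =
      site_potential e (site e (k + 1) - 1) + ln (odds e (site e (k + 1)))"
    unfolding site_potential_def by (rule cumulative_step)
  ultimately show ?thesis by (simp add: odds_site[OF e])
qed

lemma site_potential_site:
  assumes e: "e \<in> space seq_space"
  shows "site_potential e (site e k) = potential e k"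
proof (induction k rule: int_induct[where k = 0])
  case base
  show ?case by (simp add: site_potential_def potential_def)
next
  case (step1 k)
  then show ?case
    using site_potential_site_Suc[OF e, of k] cumulative_Suc[of "\<lambda>k. ln (xi e k)" k]
    by (simp add: potential_def)
next
  case (step2 k)
  then show ?case
    using site_potential_site_Suc[OF e, of "k - 1"] cumulative_step[of "\<lambda>k. ln (xi e k)" k]
    by (simp add: potential_def)
qed

text \<open>All unit steps of a block carry the same weight. The gap is moved into the exponent so
  that linear bounds on the potential plus the log gap apply directly.\<close>

lemma scale_site_Suc:
  assumes e: "e \<in> space seq_space"
  shows "scale e (site e (k + 1)) = scale e (site e k) + exp (potential e k + ln (real (gap e (k + 1))))"
proof -
  have "scale e (site e k + int m) = scale e (site e k) + real m * exp (potential e k)"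
    if "m \<le> gap e (k + 1)" for m
    using that
  proof (induction m)
    case (Suc m)
    have "scale e (site e k + int m + 1) = scale e (site e k + int m) + exp (potential e k)"
      using scale_Suc[of e "site e k + int m"] site_potential_block[OF e, of m k] Suc.prems
      by (simp add: site_potential_site[OF e])
    then show ?case using Suc by (simp add: algebra_simps)
  qed simp
  then have "scale e (site e (k + 1)) = scale e (site e k) + real (gap e (k + 1)) * exp (potential e k)"
    by (simp add: site_Suc)
  then show ?thesis using gap_pos[OF e, of "k + 1"] by (simp add: exp_add mult.commute)
qed

lemma scale_site_of_nat:
  assumes e: "e \<in> space seq_space"
  shows "scale e (site e (int N)) =
    (\<Sum>n<N. exp (potential e (int n) + ln (real (gap e (int n + 1)))))"
proof (induction N)
  case 0
  show ?case by (simp add: scale_def)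
next
  case (Suc N)
  then show ?case using scale_site_Suc[OF e, of "int N"] by (simp add: add.commute)
qed

lemma scale_site_of_neg_nat:
  assumes e: "e \<in> space seq_space"
  shows "scale e (site e (- int N)) =
    - (\<Sum>n<N. exp (potential e (- int (Suc n)) + ln (real (gap e (- int n)))))"
proof (induction N)
  case 0
  show ?case by (simp add: scale_def)
next
  case (Suc N)
  then show ?case using scale_site_Suc[OF e, of "- int (Suc N)"] by simp
qed

lemma scale_mono: "i \<le> j \<Longrightarrow> scale e i \<le> scale e j"
proof (induction j rule: int_ge_induct)
  case (step j)
  have "scale e j \<le> scale e (j + 1)" by (simp add: scale_Suc)
  with step show ?case by linarith
qed simp

lemma site_ge: "e \<in> space seq_space \<Longrightarrow> int n \<le> site e (int n)"
proof (induction n)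
  case (Suc n)
  then show ?case using site_Suc[of e "int n"] gap_pos[of e "int n + 1"] by (simp add: add.commute)
qed simp

lemma site_neg_le: "e \<in> space seq_space \<Longrightarrow> site e (- int n) \<le> - int n"
proof (induction n)
  case (Suc n)
  then show ?case using site_Suc[of e "- int (Suc n)"] gap_pos[of e "- int n"] by simp
qed simp

section \<open>Boundedness of the scale function in terms of the potential\<close>

lemma exp_sums_bounded:
  fixes v :: "nat \<Rightarrow> real"
  assumes "0 < c" and le: "\<And>n. v n \<le> C - c * real n"
  shows "\<exists>B. \<forall>N. (\<Sum>n<N. exp (v n)) \<le> B"
proof -
  have g: "summable (\<lambda>n. exp C * exp (- c) ^ n)"
    using \<open>0 < c\<close> by (intro summable_mult summable_geometric) simp
  have "exp (v n) \<le> exp C * exp (- c) ^ n" for n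
  proof -
    have "exp (v n) \<le> exp (C - c * real n)" using le by simp
    also have "\<dots> = exp C * exp (- c) ^ n"
      by (simp add: exp_diff exp_minus power_inverse exp_of_nat_mult[symmetric] divide_inverse mult.commute)
    finally show ?thesis .
  qed
  then have s: "summable (\<lambda>n. exp (v n))"
    by (intro summable_comparison_test'[OF g, of 0]) simp
  have "(\<Sum>n<N. exp (v n)) \<le> (\<Sum>n. exp (v n))" for N
    by (rule sum_le_suminf[OF s]) auto
  then show ?thesis by blast
qed

text \<open>Positive terms with bounded partial sums tend to 0. In the uses, \<open>w\<close> is the
  potential \<open>v\<close> plus a log gap, which is nonnegative.\<close>

lemma at_bot_if_exp_sums_bounded:
  fixes v w :: "nat \<Rightarrow> real"
  assumes le: "\<And>n. v n \<le> w n" and bounded: "\<And>N. (\<Sum>n<N. exp (w n)) \<le> B"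
  shows "filterlim v at_bot sequentially"
proof -
  have "summable (\<lambda>n. exp (w n))"
    by (rule bounded_imp_summable[where B = B])
       (use bounded in \<open>auto simp: lessThan_Suc_atMost[symmetric] simp del: sum.lessThan_Suc\<close>)
  then have lim: "(\<lambda>n. exp (w n)) \<longlonglongrightarrow> 0" by (rule summable_LIMSEQ_zero)
  show ?thesis unfolding filterlim_at_bot
  proof
    fix Z :: real
    have "eventually (\<lambda>n. exp (w n) < exp Z) sequentially"
      by (rule order_tendstoD(2)[OF lim]) simp
    then show "eventually (\<lambda>n. v n \<le> Z) sequentially"
      by eventually_elim (use le in \<open>auto intro: order_trans less_imp_le\<close>)
  qed
qed

lemma scale_bounded_above:
  assumes e: "e \<in> space seq_space" and "0 < c"
    and le: "\<And>n. potential e (int n) + ln (real (gap e (int n + 1))) \<le> C - c * real n"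
  shows "\<exists>B. \<forall>i. scale e i \<le> B"
proof -
  obtain B where B: "\<And>N. scale e (site e (int N)) \<le> B"
    using exp_sums_bounded[OF \<open>0 < c\<close> le] scale_site_of_nat[OF e] by auto
  have "scale e i \<le> B" for i
  proof -
    have "i \<le> site e (int (nat i))" using site_ge[OF e, of "nat i"] by linarith
    then show ?thesis using scale_mono B order_trans by blast
  qed
  then show ?thesis by blast
qed

lemma scale_bounded_below:
  assumes e: "e \<in> space seq_space" and "0 < c"
    and le: "\<And>n. potential e (- int n) + ln (real (gap e (1 - int n))) \<le> C - c * real n"
  shows "\<exists>B. \<forall>i. B \<le> scale e i"
proof -
  \<comment> \<open>The block ending at index \<open>- n\<close> carries the potential of its left
    end, so the hypothesis is read at \<open>Suc n\<close>, which turns \<open>C\<close> into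
    \<open>C - c\<close>.\<close>
  have "potential e (- int (Suc n)) + ln (real (gap e (- int n))) \<le> (C - c) - c * real n" for n
    using le[of "Suc n"] by (simp add: algebra_simps)
  then obtain B where B: "\<And>N. - B \<le> scale e (site e (- int N))"
    using exp_sums_bounded[OF \<open>0 < c\<close>, of "\<lambda>n. potential e (- int (Suc n)) + ln (real (gap e (- int n)))"]
      scale_site_of_neg_nat[OF e] by fastforce
  have "- B \<le> scale e i" for i
  proof -
    have "site e (- int (nat (- i))) \<le> i" using site_neg_le[OF e, of "nat (- i)"] by linarith
    then show ?thesis using scale_mono B order_trans by blast
  qed
  then show ?thesis by blast
qed

lemma ln_gap_nonneg: "e \<in> space seq_space \<Longrightarrow> 0 \<le> ln (real (gap e k))"
  using gap_pos[of e k] by simp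

lemma scale_unbounded_above:
  assumes e: "e \<in> space seq_space"
    and not: "\<not> filterlim (\<lambda>n. potential e (int n)) at_bot sequentially"
  shows "\<exists>i. C < scale e i"
proof (rule ccontr)
  assume "\<not> (\<exists>i. C < scale e i)"
  then have "scale e (site e (int N)) \<le> C" for N by (simp add: not_less)
  then have "filterlim (\<lambda>n. potential e (int n)) at_bot sequentially"
    using ln_gap_nonneg[OF e] unfolding scale_site_of_nat[OF e]
    by (intro at_bot_if_exp_sums_bounded[where w = "\<lambda>n. potential e (int n) + ln (real (gap e (int n + 1)))"])
       auto
  with not show False ..
qed

lemma scale_unbounded_below:
  assumes e: "e \<in> space seq_space"
    and not: "\<not> filterlim (\<lambda>n. potential e (- int n)) at_bot sequentially"
  shows "\<exists>i. scale e i < C"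
proof (rule ccontr)
  assume "\<not> (\<exists>i. scale e i < C)"
  then have le: "C \<le> scale e i" for i by (simp add: not_less)
  let ?w = "\<lambda>n. potential e (- int (Suc n)) + ln (real (gap e (- int n)))"
  have "(\<Sum>n<N. exp (?w n)) \<le> - C" for N
    using le[of "site e (- int N)"] unfolding scale_site_of_neg_nat[OF e] by simp
  then have "filterlim (\<lambda>n. potential e (- int (Suc n))) at_bot sequentially"
    by (rule at_bot_if_exp_sums_bounded[where w = ?w, rotated]) (use ln_gap_nonneg[OF e] in simp)
  then have "filterlim (\<lambda>n. potential e (- int n)) at_bot sequentially"
    by (rule filterlim_sequentially_Suc[THEN iffD1])
  with not show False ..
qed

section \<open>The walk in a stationary environment\<close>

lemma harmonic_walk_sparse_env:
  assumes e: "e \<in> space seq_space"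
  shows "harmonic_walk (sparse_env e) (scale e)"
proof
  fix i
  show "0 < sparse_env e i" "sparse_env e i < 1" by (rule sparse_env_bounds[OF e])+
  show "scale e i < scale e (i + 1)" by (simp add: scale_Suc)
  have "exp (site_potential e i) = exp (site_potential e (i - 1)) * odds e i"
    unfolding site_potential_def using odds_pos[OF e, of i]
    by (subst cumulative_step) (simp add: exp_add)
  then show "sparse_env e i * (scale e (i + 1) - scale e i) = (1 - sparse_env e i) * (scale e i - scale e (i - 1))"
    using scale_Suc[of e i] scale_Suc[of e "i - 1"] sparse_env_bounds[OF e, of i]
    by (simp add: odds_def)
qed

text \<open>The inverse of \<open>shift\<close>, whose orbits run through the negative
  indices.\<close>

definition unshift :: "(int \<Rightarrow> 'a) \<Rightarrow> int \<Rightarrow> 'a" where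
  "unshift e k = e (k - 1)"

lemma shift_unshift [simp]: "shift (unshift e) = e" "unshift (shift e) = e"
  by (auto simp: shift_def unshift_def fun_eq_iff)

lemma funpow_shift: "(shift ^^ n) e k = e (k + int n)"
  by (induction n arbitrary: k) (auto simp: shift_def add_ac)

lemma funpow_unshift: "(unshift ^^ n) e k = e (k - int n)"
  by (induction n arbitrary: k) (auto simp: unshift_def diff_diff_eq add_ac)

lemma measurable_shift: "shift \<in> measurable seq_space seq_space"
  unfolding shift_def[abs_def] seq_space_def
  by (rule measurable_PiM_single') (auto simp: space_PiM)

lemma measurable_unshift: "unshift \<in> measurable seq_space seq_space"
  unfolding unshift_def[abs_def] seq_space_def
  by (rule measurable_PiM_single') (auto simp: space_PiM)

text \<open>As \<open>Q\<close> concerns the path alone, the exceptional set is a product, and its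
  annealed mass is the integral of quenched masses that vanish.\<close>

lemma AE_annealed:
  assumes P: "prob_space P" and sets_P: "sets P = sets seq_space"
    and Q: "{x. Q x} \<in> sets path_space"
    and AE: "AE e in P. AE x in quenched (sparse_env e). Q x"
  shows "AE (e, x) in annealed P. Q x"
proof (rule AE_I)
  let ?N = "space P \<times> {x. \<not> Q x}"
  have nQ: "{x. \<not> Q x} \<in> sets path_space"
    using sets.compl_sets[OF Q] by (simp add: Compl_eq_Diff_UNIV[symmetric] Collect_neg_eq)
  show "?N \<in> sets (annealed P)"
    unfolding sets_annealed[OF P sets_P] using nQ by simp
  have "emeasure (annealed P) ?N = (\<integral>\<^sup>+ e\<in>space P. emeasure (quenched (sparse_env e)) {x. \<not> Q x} \<partial>P)"
    by (rule emeasure_annealed_times[OF P sets_P]) (auto intro: nQ)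
  also have "\<dots> = (\<integral>\<^sup>+ e. 0 \<partial>P)"
  proof (rule nn_integral_cong_AE)
    show "AE e in P. emeasure (quenched (sparse_env e)) {x. \<not> Q x} * indicator (space P) e = 0"
      using AE
    proof eventually_elim
      case (elim e)
      then have "emeasure (quenched (sparse_env e)) {x. \<not> Q x} = 0"
        using nQ by (subst (asm) AE_iff_measurable[where N = "{x. \<not> Q x}"]) auto
      then show ?case by simp
    qed
  qed
  finally show "emeasure (annealed P) ?N = 0" by simp
  have "space (annealed P) = space P \<times> UNIV"
    using sets_eq_imp_space_eq[OF sets_annealed[OF P sets_P]] by (simp add: space_pair_measure)
  then show "{z \<in> space (annealed P). \<not> (case z of (e, x) \<Rightarrow> Q x)} \<subseteq> ?N" by auto
qed

lemma path_pred_sets: "Measurable.pred path_space Q \<Longrightarrow> {x. Q x} \<in> sets path_space"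
  using measurable_sets[of Q path_space "count_space UNIV" "{True}"] by (simp add: vimage_def)

lemma limsup_eq_infinity:
  assumes "\<And>N. \<exists>n. N \<le> (X n :: int)"
  shows "limsup (\<lambda>n. ereal (of_int (X n))) = \<infinity>"
proof -
  have io: "\<exists>n\<ge>m. N \<le> X n" for m N
  proof -
    \<comment> \<open>Larger than \<open>N\<close> and than every value up to time \<open>m\<close>,
      so a time at which \<open>K\<close> is reached comes after \<open>m\<close>.\<close>
    define K where "K = Max (insert N (X ` {..m})) + 1"
    obtain n where n: "K \<le> X n" using assms by blast
    have "X k < K" if "k \<le> m" for k
    proof -
      have "X k \<le> Max (insert N (X ` {..m}))" using that by (intro Max_ge) auto
      then show ?thesis by (simp add: K_def)
    qed
    then have "m \<le> n" using n by (meson leI linorder_not_less nat_le_linear)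
    moreover have "N \<le> Max (insert N (X ` {..m}))" by (intro Max_ge) auto
    ultimately show ?thesis using n by (intro exI[of _ n]) (simp add: K_def)
  qed
  have "ereal r \<le> limsup (\<lambda>n. ereal (of_int (X n)))" for r
    unfolding limsup_INF_SUP
  proof (rule INF_greatest)
    fix m
    obtain n where "m \<le> n" "\<lceil>r\<rceil> \<le> X n" using io by blast
    then show "ereal r \<le> (SUP n\<in>{m..}. ereal (of_int (X n)))"
      by (intro SUP_upper2[of n]) (auto simp: ceiling_le_iff)
  qed
  then show ?thesis by (metis ereal_top)
qed

lemma liminf_eq_minus_infinity:
  assumes "\<And>N. \<exists>n. (X n :: int) \<le> N"
  shows "liminf (\<lambda>n. ereal (of_int (X n))) = -\<infinity>"
proof -
  have "\<exists>n. N \<le> - X n" for N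
    using assms[of "- N"] by (metis minus_le_iff minus_minus neg_le_iff_le)
  then have "limsup (\<lambda>n. - ereal (of_int (X n))) = \<infinity>"
    using limsup_eq_infinity[of "\<lambda>n. - X n"] by simp
  then show ?thesis
    unfolding ereal_Limsup_uminus by (metis ereal_uminus_uminus uminus_ereal.simps(2))
qed

text \<open>Existence of the expectation excludes infinity minus infinity, so the sign of the
  difference is decided by comparing the two integrals.\<close>

lemma
  assumes "expectation_exists M f"
  shows ext_expectation_neg_iff:
      "ext_expectation M f < 0 \<longleftrightarrow> (\<integral>\<^sup>+ x. ennreal (f x) \<partial>M) < (\<integral>\<^sup>+ x. ennreal (- f x) \<partial>M)"
    and ext_expectation_pos_iff:
      "0 < ext_expectation M f \<longleftrightarrow> (\<integral>\<^sup>+ x. ennreal (- f x) \<partial>M) < (\<integral>\<^sup>+ x. ennreal (f x) \<partial>M)"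
    and ext_expectation_eq_0_iff:
      "ext_expectation M f = 0 \<longleftrightarrow> (\<integral>\<^sup>+ x. ennreal (- f x) \<partial>M) = (\<integral>\<^sup>+ x. ennreal (f x) \<partial>M)"
proof -
  obtain a b where ab: "(\<integral>\<^sup>+ x. ennreal (f x) \<partial>M) = a" "(\<integral>\<^sup>+ x. ennreal (- f x) \<partial>M) = b" by blast
  have fin: "a < \<infinity> \<or> b < \<infinity>"
    using assms ab by (simp add: expectation_exists_def)
  have "(enn2ereal a - enn2ereal b < 0 \<longleftrightarrow> a < b) \<and> (0 < enn2ereal a - enn2ereal b \<longleftrightarrow> b < a) \<and>
      (enn2ereal a - enn2ereal b = 0 \<longleftrightarrow> b = a)"
    using fin by (cases a; cases b) (auto simp: ennreal_less_iff ennreal_inj)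
  then show "ext_expectation M f < 0 \<longleftrightarrow> (\<integral>\<^sup>+ x. ennreal (f x) \<partial>M) < (\<integral>\<^sup>+ x. ennreal (- f x) \<partial>M)"
    "0 < ext_expectation M f \<longleftrightarrow> (\<integral>\<^sup>+ x. ennreal (- f x) \<partial>M) < (\<integral>\<^sup>+ x. ennreal (f x) \<partial>M)"
    "ext_expectation M f = 0 \<longleftrightarrow> (\<integral>\<^sup>+ x. ennreal (- f x) \<partial>M) = (\<integral>\<^sup>+ x. ennreal (f x) \<partial>M)"
    unfolding ext_expectation_def ab by simp_all
qed

section \<open>Drift and oscillation of the potential under a stationary ergodic law\<close>

locale stationary_environment = prob_space P for P :: "(int \<Rightarrow> real \<times> nat) measure" +
  assumes sets_P: "sets P = sets seq_space"
    and stationary: "stationary_law P"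
    and ergodic: "ergodic_law P"
    and ln_gap_integral: "(\<integral>\<^sup>+ e. ennreal (ln (real (gap e 0))) \<partial>P) < \<infinity>"
begin

lemma space_P: "space P = space seq_space"
  by (rule sets_eq_imp_space_eq[OF sets_P])

lemma measurable_P: "f \<in> measurable seq_space N \<Longrightarrow> f \<in> measurable P N"
  by (simp add: measurable_cong_sets[OF sets_P refl])

lemma measurable_ln_xi: "(\<lambda>e. ln (xi e k)) \<in> borel_measurable P"
  by (rule measurable_P) (unfold xi_def, measurable)

lemma measurable_ln_gap: "(\<lambda>e. ln (real (gap e k))) \<in> borel_measurable P"
  by (rule measurable_P) measurable

sublocale right: ergodic_system P shift
proof
  show "shift \<in> measurable P P"
    using measurable_shift by (simp add: measurable_cong_sets[OF sets_P sets_P])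
  show "distr P P shift = P" using stationary by (simp add: stationary_law_def)
  show "prob A = 0 \<or> prob A = 1" if "A \<in> events" "shift -` A \<inter> space P = A" for A
    using ergodic that by (simp add: ergodic_law_def)
qed

text \<open>The inverse of a measure-preserving bijection preserves the measure and has the same
  invariant sets.\<close>

sublocale left: ergodic_system P unshift
proof
  show m: "unshift \<in> measurable P P"
    using measurable_unshift by (simp add: measurable_cong_sets[OF sets_P sets_P])
  have "distr P P unshift = distr (distr P P shift) P unshift"
    by (simp add: right.T_preserving)
  also have "\<dots> = distr P P (\<lambda>e. e)"
    by (subst distr_distr[OF m right.T_measurable]) (simp add: comp_def)
  finally show "distr P P unshift = P" by (simp add: distr_id)
  show "prob A = 0 \<or> prob A = 1" if A: "A \<in> events" "unshift -` A \<inter> space P = A" for A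
  proof (rule right.T_ergodic[OF A(1)])
    have "shift e \<in> A \<longleftrightarrow> e \<in> A" if e: "e \<in> space P" for e
    proof -
      have "shift e \<in> space P" by (rule right.T_space[OF e])
      then have "shift e \<in> A \<longleftrightarrow> shift e \<in> unshift -` A \<inter> space P" using A(2) by simp
      also have "\<dots> \<longleftrightarrow> e \<in> A" using \<open>shift e \<in> space P\<close> by simp
      finally show ?thesis .
    qed
    then show "shift -` A \<inter> space P = A" using sets.sets_into_space[OF A(1)] by auto
  qed
qed

text \<open>Sums to the right begin at index 1, which makes \<open>ln (xi e 1)\<close> the
  observable; to the left they begin at index 0 with reversed sign.\<close>

lemma potential_right: "potential e (int n) = right.birkhoff_sum (\<lambda>e. ln (xi e 1)) n e"
  unfolding potential_def cumulative_of_nat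
  by (simp add: xi_def lam_def funpow_shift add.commute)

lemma potential_left: "potential e (- int n) = left.birkhoff_sum (\<lambda>e. - ln (xi e 0)) n e"
  unfolding potential_def cumulative_of_neg_nat
  by (simp add: xi_def lam_def funpow_unshift)

text \<open>Taken for the identity and for \<open>uminus\<close>, this transfers both parts of the
  mean from index 1 to index 0.\<close>

lemma nn_integral_xi_1:
  assumes [measurable]: "\<phi> \<in> borel_measurable borel"
  shows "(\<integral>\<^sup>+ e. ennreal (\<phi> (ln (xi e 1))) \<partial>P) = (\<integral>\<^sup>+ e. ennreal (\<phi> (ln (xi e 0))) \<partial>P)"
proof -
  show ?thesis
    using right.nn_integral_T[of "\<lambda>e. ennreal (\<phi> (ln (xi e 0)))", OF measurable_compose[OF measurable_ln_xi]]
    by (simp add: xi_def lam_def shift_def)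
qed

lemma ln_gap_1_integral: "(\<integral>\<^sup>+ e. ennreal (ln (real (gap e 1))) \<partial>P) < \<infinity>"
  using right.nn_integral_T[of "\<lambda>e. ennreal (ln (real (gap e 0)))"] measurable_ln_gap[of 0] ln_gap_integral
  by (simp add: gap_def shift_def)

text \<open>The block exponent at \<open>n\<close> is a Birkhoff sum plus the log gap of index 1
  seen from the environment shifted \<open>n\<close> times.\<close>

lemma right_drift:
  assumes "(\<integral>\<^sup>+ e. ennreal (ln (xi e 0)) \<partial>P) < (\<integral>\<^sup>+ e. ennreal (- ln (xi e 0)) \<partial>P)"
  shows "AE e in P. \<exists>B. \<forall>i. scale e i \<le> B"
proof -
  have "AE e in P. \<exists>C c. 0 < c \<and> (\<forall>n. right.birkhoff_sum (\<lambda>e. ln (xi e 1)) n e +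
      ln (real (gap ((shift ^^ n) e) 1)) \<le> C - c * real n)"
    using assms nn_integral_xi_1[of "\<lambda>x. x"] nn_integral_xi_1[of uminus]
    by (intro right.AE_birkhoff_sum_plus_le_linear measurable_ln_xi measurable_ln_gap ln_gap_1_integral)
       (auto simp: ln_gap_nonneg space_P)
  then show ?thesis using AE_space
  proof eventually_elim
    case (elim e)
    then obtain C c where "0 < c"
      "\<And>n. potential e (int n) + ln (real (gap e (int n + 1))) \<le> C - c * real n"
      by (auto simp: potential_right gap_def funpow_shift add.commute)
    then show ?case using elim(2) by (intro scale_bounded_above) (simp_all add: space_P)
  qed
qed

text \<open>A positive mean makes the potential fall linearly towards the left; after
  \<open>n\<close> inverse shifts the gap of index \<open>1 - n\<close> again has index 1.\<close>

lemma left_drift: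
  assumes "(\<integral>\<^sup>+ e. ennreal (- ln (xi e 0)) \<partial>P) < (\<integral>\<^sup>+ e. ennreal (ln (xi e 0)) \<partial>P)"
  shows "AE e in P. \<exists>B. \<forall>i. B \<le> scale e i"
proof -
  have "AE e in P. \<exists>C c. 0 < c \<and> (\<forall>n. left.birkhoff_sum (\<lambda>e. - ln (xi e 0)) n e +
      ln (real (gap ((unshift ^^ n) e) 1)) \<le> C - c * real n)"
    using assms
    by (intro left.AE_birkhoff_sum_plus_le_linear borel_measurable_uminus measurable_ln_xi
          measurable_ln_gap ln_gap_1_integral)
       (auto simp: ln_gap_nonneg space_P)
  then show ?thesis using AE_space
  proof eventually_elim
    case (elim e)
    then obtain C c where "0 < c"
      "\<And>n. potential e (- int n) + ln (real (gap e (1 - int n))) \<le> C - c * real n"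
      by (auto simp: potential_left gap_def funpow_unshift)
    then show ?case using elim(2) by (intro scale_bounded_below) (simp_all add: space_P)
  qed
qed

lemma right_unbounded:
  assumes "(\<integral>\<^sup>+ e. ennreal (- ln (xi e 0)) \<partial>P) \<le> (\<integral>\<^sup>+ e. ennreal (ln (xi e 0)) \<partial>P)"
    and "(\<integral>\<^sup>+ e. ennreal (- ln (xi e 0)) \<partial>P) < \<infinity>"
  shows "AE e in P. \<forall>C. \<exists>i. C < scale e i"
proof -
  have "AE e in P. \<not> filterlim (\<lambda>n. right.birkhoff_sum (\<lambda>e. ln (xi e 1)) n e) at_bot sequentially"
    using assms nn_integral_xi_1[of "\<lambda>x. x"] nn_integral_xi_1[of uminus]
    by (intro right.AE_birkhoff_sum_not_at_bot_ext measurable_ln_xi) auto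
  then show ?thesis using AE_space
    by eventually_elim (auto simp: space_P potential_right[symmetric] intro: scale_unbounded_above)
qed

lemma left_unbounded:
  assumes "(\<integral>\<^sup>+ e. ennreal (ln (xi e 0)) \<partial>P) \<le> (\<integral>\<^sup>+ e. ennreal (- ln (xi e 0)) \<partial>P)"
    and "(\<integral>\<^sup>+ e. ennreal (ln (xi e 0)) \<partial>P) < \<infinity>"
  shows "AE e in P. \<forall>C. \<exists>i. scale e i < C"
proof -
  have "AE e in P. \<not> filterlim (\<lambda>n. left.birkhoff_sum (\<lambda>e. - ln (xi e 0)) n e) at_bot sequentially"
    using assms
    by (intro left.AE_birkhoff_sum_not_at_bot_ext borel_measurable_uminus measurable_ln_xi) auto
  then show ?thesis using AE_space
    by eventually_elim (auto simp: space_P potential_left[symmetric] intro: scale_unbounded_below)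
qed

end

section \<open>The two transient regimes and the oscillating one\<close>

theorem theorem1:
  fixes P :: "(int \<Rightarrow> real \<times> nat) measure"
  assumes "prob_space P"
    and "sets P = sets seq_space"
    and "stationary_law P"
    and "ergodic_law P"
    and "expectation_exists P (\<lambda>e. ln (xi e 0))"
    and "ext_expectation P (\<lambda>e. ln (real (gap e 0))) < \<infinity>"
  shows "(ext_expectation P (\<lambda>e. ln (xi e 0)) < 0 \<longrightarrow>
            (AE (e, X) in annealed P. filterlim X at_top sequentially)) \<and>
         (ext_expectation P (\<lambda>e. ln (xi e 0)) > 0 \<longrightarrow>
            (AE (e, X) in annealed P. filterlim X at_bot sequentially)) \<and>
         (ext_expectation P (\<lambda>e. ln (xi e 0)) = 0 \<longrightarrow>
            (AE (e, X) in annealed P.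
               liminf (\<lambda>n. ereal (of_int (X n))) = -\<infinity> \<and>
               limsup (\<lambda>n. ereal (of_int (X n))) = \<infinity>))"
proof -
  interpret prob_space P by fact
  have sp: "space P = space seq_space" by (rule sets_eq_imp_space_eq) fact
  \<comment> \<open>Gaps are at least 1, so the log has no negative part and its extended
    expectation is the integral in \<open>ln_gap_integral\<close>.\<close>
  have gap0: "(\<integral>\<^sup>+ e. ennreal (- ln (real (gap e 0))) \<partial>P) = 0"
    using ln_gap_nonneg
    by (subst nn_integral_0_iff_AE)
       (auto simp: sp ennreal_neg measurable_cong_sets[OF assms(2) refl] intro!: measurable_compose[OF measurable_gap])
  have "(\<integral>\<^sup>+ e. ennreal (ln (real (gap e 0))) \<partial>P) < \<infinity>"
    using assms(6) unfolding ext_expectation_def gap0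
    by (cases "\<integral>\<^sup>+ e. ennreal (ln (real (gap e 0))) \<partial>P") auto
  then interpret stationary_environment P
    by unfold_locales (use assms in auto)
  let ?a = "\<integral>\<^sup>+ e. ennreal (ln (xi e 0)) \<partial>P" and ?b = "\<integral>\<^sup>+ e. ennreal (- ln (xi e 0)) \<partial>P"
  note iffs = ext_expectation_neg_iff[OF assms(5)] ext_expectation_pos_iff[OF assms(5)]
    ext_expectation_eq_0_iff[OF assms(5)]
  show ?thesis
  proof (intro conjI impI)
    assume "ext_expectation P (\<lambda>e. ln (xi e 0)) < 0"
    then have less: "?a < ?b" unfolding iffs .
    \<comment> \<open>Strictness makes the smaller part finite, as \<open>left_unbounded\<close>
      requires: for \<open>- ln (xi e 0)\<close> this is the negative part.\<close>
    then have "?a < \<infinity>" by (metis infinity_ennreal_def less_top order_less_le_trans top_greatest)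
    have "AE e in P. AE x in quenched (sparse_env e). filterlim x at_top sequentially"
      using right_drift[OF less] left_unbounded[OF less_imp_le[OF less] \<open>?a < \<infinity>\<close>] AE_space
    proof eventually_elim
      case (elim e)
      then obtain B where "\<And>i. scale e i \<le> B" by blast
      with elim show ?case
        by (intro harmonic_walk.AE_at_top[OF harmonic_walk_sparse_env]) (auto simp: space_P)
    qed
    moreover have "{x :: nat \<Rightarrow> int. filterlim x at_top sequentially} \<in> sets path_space"
      unfolding filterlim_at_top eventually_sequentially by (rule path_pred_sets) measurable
    ultimately show "AE (e, X) in annealed P. filterlim X at_top sequentially"
      by (intro AE_annealed[OF assms(1,2)])
  next
    assume "0 < ext_expectation P (\<lambda>e. ln (xi e 0))"
    then have less: "?b < ?a" unfolding iffs .
    then have "?b < \<infinity>" by (metis infinity_ennreal_def less_top order_less_le_trans top_greatest)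
    have "AE e in P. AE x in quenched (sparse_env e). filterlim x at_bot sequentially"
      using left_drift[OF less] right_unbounded[OF less_imp_le[OF less] \<open>?b < \<infinity>\<close>] AE_space
    proof eventually_elim
      case (elim e)
      then obtain B where "\<And>i. B \<le> scale e i" by blast
      with elim show ?case
        by (intro harmonic_walk.AE_at_bot[OF harmonic_walk_sparse_env]) (auto simp: space_P)
    qed
    moreover have "{x :: nat \<Rightarrow> int. filterlim x at_bot sequentially} \<in> sets path_space"
      unfolding filterlim_at_bot eventually_sequentially by (rule path_pred_sets) measurable
    ultimately show "AE (e, X) in annealed P. filterlim X at_bot sequentially"
      by (intro AE_annealed[OF assms(1,2)])
  next
    assume "ext_expectation P (\<lambda>e. ln (xi e 0)) = 0"
    then have eq: "?b = ?a" unfolding iffs .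
    \<comment> \<open>The two parts are equal and not both infinite.\<close>
    then have fin: "?a < \<infinity>" "?b < \<infinity>" using assms(5) by (auto simp: expectation_exists_def)
    have "AE e in P. AE x in quenched (sparse_env e). (\<forall>N. \<exists>n. N \<le> x n) \<and> (\<forall>N. \<exists>n. x n \<le> N)"
      using right_unbounded[OF eq_refl[OF eq] fin(2)] left_unbounded[OF eq_refl[OF eq[symmetric]] fin(1)] AE_space
    proof eventually_elim
      case (elim e)
      then show ?case
        by (intro AE_conjI harmonic_walk.AE_sup_infinite[OF harmonic_walk_sparse_env]
            harmonic_walk.AE_inf_infinite[OF harmonic_walk_sparse_env]) (auto simp: space_P)
    qed
    moreover have "{x :: nat \<Rightarrow> int. (\<forall>N. \<exists>n. N \<le> x n) \<and> (\<forall>N. \<exists>n. x n \<le> N)} \<in> sets path_space"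
      by (rule path_pred_sets) measurable
    ultimately have "AE (e, X) in annealed P. (\<forall>N. \<exists>n. N \<le> X n) \<and> (\<forall>N. \<exists>n. X n \<le> N)"
      by (intro AE_annealed[OF assms(1,2)])
    then show "AE (e, X) in annealed P. liminf (\<lambda>n. ereal (of_int (X n))) = -\<infinity> \<and>
        limsup (\<lambda>n. ereal (of_int (X n))) = \<infinity>"
      by eventually_elim (auto intro!: liminf_eq_minus_infinity limsup_eq_infinity)
  qed
qed

end
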